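(* Let $T:[0,1]^2\to[0,1]^2$ be defined by $$T(x,y)=\left(\frac{\lfloor 1/y\rfloor}{x}-\left\lfloor\frac{\lfloor 1/y\rfloor}{x}\right\rfloor,\ \frac1y-\left\lfloor\frac1y\right\rfloor\right)\quad\text{if }x\neq0\text{ and }y\neq0,$$ and $T(x,y)=(0,0)$ if $x=0$ or $y=0$ (or both). Then the map $T$ is ergodic with respect to a measure mutually absolutely continuous to Lebesgue measure. Moreover, it is even exponentially mixing.
   Context: Here $\lfloor\cdot\rfloor$ denotes the integer part, and Lebesgue measure is the two-dimensional Lebesgue measure on $[0,1]^2$. The second coordinate of $T$ is the Gauss map. Iterating $T$ on $(x,y)$ produces the proper continued fraction expansion of $x$, that is, an expansion $x=\cfrac{a_1}{b_1+\cfrac{a_2}{b_2+\ddots}}$ with positive integers $a_n$ and integers $b_n\ge a_n$, whose numerators $a_n$ are the regular continued fraction partial quotients of $y$. *)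

theory Defs
  imports "HOL-Probability.Probability"
begin

definition unit_square :: "(real \<times> real) set" where
  "unit_square = {0..1} \<times> {0..1}"

definition proper_cf_map :: "real \<times> real \<Rightarrow> real \<times> real" where
  "proper_cf_map = (\<lambda>(x, y).
     if x \<noteq> 0 \<and> y \<noteq> 0
     then (of_int \<lfloor>1 / y\<rfloor> / x - of_int \<lfloor>of_int \<lfloor>1 / y\<rfloor> / x\<rfloor>,
           1 / y - of_int \<lfloor>1 / y\<rfloor>)
     else (0, 0))"

definition measure_preserving :: "'a measure \<Rightarrow> ('a \<Rightarrow> 'a) \<Rightarrow> bool" where
  "measure_preserving M T \<longleftrightarrow>
     T \<in> measurable M M \<and> (\<forall>A\<in>sets M. emeasure M (T -` A \<inter> space M) = emeasure M A)"

definition ergodic :: "'a measure \<Rightarrow> ('a \<Rightarrow> 'a) \<Rightarrow> bool" where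
  "ergodic M T \<longleftrightarrow>
     measure_preserving M T \<and>
     (\<forall>A\<in>sets M. T -` A \<inter> space M = A \<longrightarrow>
        emeasure M A = 0 \<or> emeasure M (space M - A) = 0)"

text \<open>
  Mutual absolute continuity. The library's \<^const>\<open>absolutely_continuous\<close> only compares null
  sets, so agreement of the sigma-algebras is required separately.
\<close>

definition mutually_absolutely_continuous :: "'a measure \<Rightarrow> 'a measure \<Rightarrow> bool" where
  "mutually_absolutely_continuous M N \<longleftrightarrow>
     sets M = sets N \<and> absolutely_continuous M N \<and> absolutely_continuous N M"

text \<open>
  Exponential decay of correlations, for a Borel probability measure \<open>M\<close> on a subset of a metric
  space: for every Hoelder exponent \<open>\<alpha>\<close> there are \<open>C\<close> and \<open>\<theta> < 1\<close> such that
  the correlation of a Hoelder function \<open>\<phi>\<close> with \<open>\<psi> \<circ> T\<^sup>n\<close> for essentially bounded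
  \<open>\<psi>\<close> is at most \<open>C \<theta>\<^sup>n\<close> times the product of the \<open>\<alpha>\<close>-Hoelder norm of \<open>\<phi>\<close>
  (sup norm plus Hoelder seminorm) and the essential supremum norm of \<open>\<psi>\<close>.
  The bounds \<open>S\<close>, \<open>H\<close>, \<open>B\<close> range over all upper bounds of the sup norm, the Hoelder
  seminorm and the essential supremum norm; the inequality for these norms is the instance with
  the least such bounds.
\<close>

definition exponentially_mixing :: "'a::metric_space measure \<Rightarrow> ('a \<Rightarrow> 'a) \<Rightarrow> bool" where
  "exponentially_mixing M T \<longleftrightarrow>
     measure_preserving M T \<and>
     (\<forall>\<alpha>. 0 < \<alpha> \<and> \<alpha> \<le> 1 \<longrightarrow>
       (\<exists>C \<theta>. 0 < \<theta> \<and> \<theta> < 1 \<and>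
         (\<forall>(\<phi> :: 'a \<Rightarrow> real) (\<psi> :: 'a \<Rightarrow> real) S H B.
            (\<forall>p\<in>space M. \<bar>\<phi> p\<bar> \<le> S) \<longrightarrow>
            (\<forall>p\<in>space M. \<forall>q\<in>space M. \<bar>\<phi> p - \<phi> q\<bar> \<le> H * dist p q powr \<alpha>) \<longrightarrow>
            \<psi> \<in> borel_measurable M \<longrightarrow>
            (AE p in M. \<bar>\<psi> p\<bar> \<le> B) \<longrightarrow>
            (\<forall>n. \<bar>(LINT p|M. \<phi> p * \<psi> ((T ^^ n) p)) - (LINT p|M. \<phi> p) * (LINT p|M. \<psi> p)\<bar>
                   \<le> C * \<theta> ^ n * (S + H) * B))))"

end

(* The inverse branches of T are (x, y) |-> (a / (b + x), 1 / (a + y)) with b >= a >= 1, each defined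
   on the whole square.  In the coordinates ln (1 + x), ln (1 + y) they contract by the factor 1/2 and
   their Jacobians have uniformly bounded distortion.  Hence the transfer operator maps the cone of
   functions with f p <= exp (K d(p, q)) f q, where d is the alpha-th power of this distance, into a
   strictly smaller such cone.  A function in the smaller cone dominates a fixed fraction of its mean,
   and stays in the larger cone after this constant is subtracted; since the constant parts of two
   functions of equal mass evolve identically, the difference of their iterates decays exponentially
   in the sup norm.  This yields the invariant density as a limit of the iterates of 1, and
   exponential mixing because a Hoelder function plus a large constant, times the density, lies in
   such a cone.  Mixing against Lipschitz approximations of closed sets gives ergodicity. *)

theory Submission
  imports Defs
begin

section \<open>Operators contracting a cone of densities\<close>

text \<open>The obstacle is that the Euclidean metric shows no uniform contraction: for a = b = 1
  the branch x |-> 1 / (1 + x) has derivative -1 at 0. Measured in ln (1 + x), the derivative of ln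
  (1 + a / (b + x)) is - a (1 + x) / ((b + x) (b + x + a)), and the properness condition a \<le> b
  is what keeps its absolute value below 1/2. Every branch is full, so no partition has to be
  tracked, and the coupling yields an explicit rate without compactness or spectral arguments. Cone
  members take values in \<open>ennreal\<close>: the countable sums over branches then raise no
  question of convergence, and the integrals none of integrability. Subtraction there truncates at
  0, so each subtraction comes with a domination estimate. The rate depends on \<alpha>, but the
  density is built only once, for exponent 1: logarithmic distances are at most 1, hence are
  dominated by their \<alpha>-th powers, and the exponent-1 cone lies in the cone of exponent
  \<alpha> with the same constant.\<close>

definition log_cone :: "'a measure \<Rightarrow> ('a \<Rightarrow> 'a \<Rightarrow> real) \<Rightarrow> real \<Rightarrow> ('a \<Rightarrow> ennreal) set" where
  "log_cone M d K = {f \<in> borel_measurable M.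
     \<forall>p\<in>space M. \<forall>q\<in>space M. f p \<le> ennreal (exp (K * d p q)) * f q}"

lemma log_cone_measurable: "f \<in> log_cone M d K \<Longrightarrow> f \<in> borel_measurable M"
  by (simp add: log_cone_def)

lemma log_coneD:
  "f \<in> log_cone M d K \<Longrightarrow> p \<in> space M \<Longrightarrow> q \<in> space M \<Longrightarrow> f p \<le> ennreal (exp (K * d p q)) * f q"
  by (simp add: log_cone_def)

lemma log_cone_mono:
  assumes "f \<in> log_cone M d K"
    and "\<And>p q. p \<in> space M \<Longrightarrow> q \<in> space M \<Longrightarrow> K * d p q \<le> K' * d' p q"
  shows "f \<in> log_cone M d' K'"
  unfolding log_cone_def
proof (intro CollectI conjI ballI)
  show "f \<in> borel_measurable M" using assms(1) by (rule log_cone_measurable)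
  fix p q assume pq: "p \<in> space M" "q \<in> space M"
  have "f p \<le> ennreal (exp (K * d p q)) * f q" by (rule log_coneD[OF assms(1) pq])
  also have "\<dots> \<le> ennreal (exp (K' * d' p q)) * f q"
    using assms(2)[OF pq] by (intro mult_right_mono ennreal_leI) auto
  finally show "f p \<le> ennreal (exp (K' * d' p q)) * f q" .
qed

lemma log_cone_mult:
  assumes "f \<in> log_cone M d K" "g \<in> log_cone M d K'"
  shows "(\<lambda>p. f p * g p) \<in> log_cone M d (K + K')"
  unfolding log_cone_def
proof (intro CollectI conjI ballI)
  show "(\<lambda>p. f p * g p) \<in> borel_measurable M"
    using assms[THEN log_cone_measurable] by simp
  fix p q assume pq: "p \<in> space M" "q \<in> space M"
  have "f p * g p \<le> (ennreal (exp (K * d p q)) * f q) * (ennreal (exp (K' * d p q)) * g q)"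
    using assms[THEN log_coneD, OF pq] by (intro mult_mono) auto
  also have "\<dots> = (ennreal (exp (K * d p q)) * ennreal (exp (K' * d p q))) * (f q * g q)"
    by (simp add: mult_ac)
  also have "ennreal (exp (K * d p q)) * ennreal (exp (K' * d p q)) = ennreal (exp ((K + K') * d p q))"
    by (simp add: ennreal_mult'[symmetric] exp_add[symmetric] algebra_simps)
  finally show "f p * g p \<le> ennreal (exp ((K + K') * d p q)) * (f q * g q)" .
qed

lemma log_cone_const_mult:
  assumes "f \<in> log_cone M d K"
  shows "(\<lambda>p. r * f p) \<in> log_cone M d K"
  unfolding log_cone_def
proof (intro CollectI conjI ballI)
  show "(\<lambda>p. r * f p) \<in> borel_measurable M"
    using assms[THEN log_cone_measurable] by simp
  fix p q assume pq: "p \<in> space M" "q \<in> space M"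
  show "r * f p \<le> ennreal (exp (K * d p q)) * (r * f q)"
    using mult_left_mono[OF log_coneD[OF assms pq], of r] by (simp add: mult_ac)
qed

lemma log_cone_add_const:
  assumes "f \<in> log_cone M d K" "0 \<le> K" "\<And>p q. 0 \<le> d p q"
  shows "(\<lambda>p. f p + r) \<in> log_cone M d K"
  unfolding log_cone_def
proof (intro CollectI conjI ballI)
  show "(\<lambda>p. f p + r) \<in> borel_measurable M"
    using assms(1)[THEN log_cone_measurable] by simp
  fix p q assume pq: "p \<in> space M" "q \<in> space M"
  have "1 * r \<le> ennreal (exp (K * d p q)) * r"
    using assms(2,3) by (intro mult_right_mono) (auto simp: ennreal_1[symmetric] simp del: ennreal_1 intro!: ennreal_leI)
  then show "f p + r \<le> ennreal (exp (K * d p q)) * (f q + r)"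
    using add_mono[OF log_coneD[OF assms(1) pq], of r] by (simp add: distrib_left)
qed

text \<open>Dividing by the exponential first turns the claim into a lower bound valid for every
  \<open>f n q\<close>, so the two infima need not be matched index by index. Closure under infima
  makes the limit density a cone member without a limit argument.\<close>

lemma log_cone_INF:
  fixes f :: "nat \<Rightarrow> 'a \<Rightarrow> ennreal"
  assumes "\<And>n. f n \<in> log_cone M d K"
  shows "(\<lambda>p. INF n. f n p) \<in> log_cone M d K"
  unfolding log_cone_def
proof (intro CollectI conjI ballI)
  show "(\<lambda>p. INF n. f n p) \<in> borel_measurable M"
    using assms[THEN log_cone_measurable] by simp
  fix p q assume pq: "p \<in> space M" "q \<in> space M"
  let ?e = "ennreal (exp (K * d p q))" and ?e' = "ennreal (exp (- (K * d p q)))"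
  have cancel: "?e * ?e' = 1" by (simp add: ennreal_mult'[symmetric] exp_minus)
  have "?e' * (INF n. f n p) \<le> (INF n. f n q)"
  proof (rule INF_greatest)
    fix n
    have "?e' * (INF n. f n p) \<le> ?e' * (?e * f n q)"
      using log_coneD[OF assms[of n] pq] by (intro mult_left_mono) (auto intro: INF_lower2)
    also have "\<dots> = f n q" using cancel by (metis mult.assoc mult.commute mult_1)
    finally show "?e' * (INF n. f n p) \<le> f n q" .
  qed
  from mult_left_mono[OF this, of ?e] have "?e * ?e' * (INF n. f n p) \<le> ?e * (INF n. f n q)"
    by (simp add: mult.assoc)
  then have "(INF n. f n p) \<le> ?e * (INF n. f n q)" unfolding cancel by simp
  then show "(INF n. f n p) \<le> ennreal (exp (K * d p q)) * (INF n. f n q)" .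
qed

text \<open>\<open>L\<close> is the transfer operator dual to composition with \<open>T\<close>. In
  \<open>L_cone\<close>, \<open>c\<close> is the distortion added by the Jacobians and
  \<open>\<kappa>\<close> the contraction of the branches, so every \<open>K\<close> above c / (1 -
  \<kappa>) is strictly improved. \<open>L_linear\<close> has the form needed to split off a
  multiple of the constant 1.\<close>

locale contracting_transfer = prob_space M for M :: "'a measure" +
  fixes T :: "'a \<Rightarrow> 'a" and L :: "('a \<Rightarrow> ennreal) \<Rightarrow> 'a \<Rightarrow> ennreal"
    and d :: "'a \<Rightarrow> 'a \<Rightarrow> real" and c \<kappa> :: real
  assumes T_measurable [measurable]: "T \<in> M \<rightarrow>\<^sub>M M"
    and L_measurable: "f \<in> borel_measurable M \<Longrightarrow> L f \<in> borel_measurable M"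
    and L_cong: "(\<And>q. q \<in> space M \<Longrightarrow> f q = g q) \<Longrightarrow> p \<in> space M \<Longrightarrow> L f p = L g p"
    and L_linear: "L (\<lambda>q. f q + r * g q) p = L f p + r * L g p"
    and duality: "f \<in> borel_measurable M \<Longrightarrow> g \<in> borel_measurable M \<Longrightarrow>
        (\<integral>\<^sup>+p. f p * g (T p) \<partial>M) = (\<integral>\<^sup>+p. L f p * g p \<partial>M)"
    and d_nonneg: "0 \<le> d p q"
    and d_le_1: "p \<in> space M \<Longrightarrow> q \<in> space M \<Longrightarrow> d p q \<le> 1"
    and c_nonneg: "0 \<le> c" and \<kappa>_nonneg: "0 \<le> \<kappa>" and \<kappa>_less_1: "\<kappa> < 1"
    and L_cone: "0 \<le> K \<Longrightarrow> f \<in> log_cone M d K \<Longrightarrow> L f \<in> log_cone M d (c + \<kappa> * K)"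
begin

lemma T_pow_measurable [measurable]: "T ^^ n \<in> M \<rightarrow>\<^sub>M M"
  by (induction n) (auto simp: comp_def intro: measurable_compose)

lemma L_pow_measurable: "f \<in> borel_measurable M \<Longrightarrow> (L ^^ n) f \<in> borel_measurable M"
  by (induction n) (auto intro: L_measurable)

lemma L_pow_cong:
  "(\<And>q. q \<in> space M \<Longrightarrow> f q = g q) \<Longrightarrow> p \<in> space M \<Longrightarrow> (L ^^ n) f p = (L ^^ n) g p"
proof (induction n arbitrary: p)
  case (Suc n)
  show ?case using L_cong[OF Suc.IH[OF Suc.prems(1)] Suc.prems(2)] by simp
qed simp

lemma L_pow_linear: "(L ^^ n) (\<lambda>q. f q + r * g q) = (\<lambda>p. (L ^^ n) f p + r * (L ^^ n) g p)"
  by (induction n) (auto simp: L_linear)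

lemma duality_pow:
  assumes "f \<in> borel_measurable M" and g[measurable]: "g \<in> borel_measurable M"
  shows "(\<integral>\<^sup>+p. f p * g ((T ^^ n) p) \<partial>M) = (\<integral>\<^sup>+p. (L ^^ n) f p * g p \<partial>M)"
  using assms(1)
proof (induction n arbitrary: f)
  case (Suc n)
  have "(\<lambda>p. g ((T ^^ n) p)) \<in> borel_measurable M" by measurable
  from duality[OF Suc.prems this] Suc.IH[OF L_measurable[OF Suc.prems]]
  show ?case by (simp add: funpow_swap1 funpow_Suc_right del: funpow.simps)
qed simp

lemma nn_integral_L: "f \<in> borel_measurable M \<Longrightarrow> (\<integral>\<^sup>+p. L f p \<partial>M) = (\<integral>\<^sup>+p. f p \<partial>M)"
  using duality[of f "\<lambda>_. 1"] by simp

text \<open>Since \<open>d\<close> is at most 1, any two values differ by at most the factor exp K;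
  average over one of the two points, the total mass of \<open>M\<close> being 1.\<close>

lemma log_cone_bounds:
  assumes f: "f \<in> log_cone M d K" and K: "0 \<le> K" and m: "(\<integral>\<^sup>+p. f p \<partial>M) = ennreal m"
    and p: "p \<in> space M"
  shows "ennreal (exp (-K) * m) \<le> f p" "f p \<le> ennreal (exp K * m)"
proof -
  note [measurable] = log_cone_measurable[OF f]
  have le: "f a \<le> ennreal (exp K) * f b" if "a \<in> space M" "b \<in> space M" for a b
  proof -
    have "f a \<le> ennreal (exp (K * d a b)) * f b" by (rule log_coneD[OF f that])
    also have "\<dots> \<le> ennreal (exp K) * f b"
      using K d_le_1[OF that] by (intro mult_right_mono ennreal_leI) (auto intro: mult_left_le)
    finally show ?thesis .
  qed
  have e: "ennreal (exp (-K)) * (ennreal (exp K) * x) = x" for x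
    by (simp add: mult.assoc[symmetric] ennreal_mult'[symmetric] exp_minus)
  have "(\<integral>\<^sup>+a. f a \<partial>M) \<le> (\<integral>\<^sup>+a. ennreal (exp K) * f p \<partial>M)"
    by (intro nn_integral_mono le p)
  then have "ennreal m \<le> ennreal (exp K) * f p" by (simp add: m emeasure_space_1)
  from mult_left_mono[OF this, of "ennreal (exp (-K))"]
  show "ennreal (exp (-K) * m) \<le> f p" by (simp add: e ennreal_mult')
  have "(\<integral>\<^sup>+a. f p \<partial>M) \<le> (\<integral>\<^sup>+a. ennreal (exp K) * f a \<partial>M)"
    by (intro nn_integral_mono le p)
  then show "f p \<le> ennreal (exp K * m)"
    by (simp add: m emeasure_space_1 nn_integral_cmult ennreal_mult')
qed

text \<open>The fraction of mass that can be removed at each step. One factor exp (-K) is the lower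
  bound of a function by its mass, the other offsets exp K in exp (K t) - 1 \<le> K t exp K. The
  quotient compares the slopes K - K' and K at t = 0, where K' = c + \<kappa> K.\<close>

definition gap :: "real \<Rightarrow> real" where
  "gap K = (K - (c + \<kappa> * K)) / K * exp (- (2 * K))"

lemma gap_bounds:
  assumes "c + \<kappa> * K < K"
  shows "0 < K" "0 < gap K" "gap K < 1"
proof -
  show K: "0 < K"
  proof (rule ccontr)
    assume "\<not> 0 < K"
    then have "(1 - \<kappa>) * K \<le> 0" using \<kappa>_less_1 by (simp add: mult_nonneg_nonpos)
    with assms c_nonneg show False by (simp add: algebra_simps)
  qed
  then show "0 < gap K" using assms by (simp add: gap_def)
  have "(K - (c + \<kappa> * K)) / K \<le> 1" using K c_nonneg \<kappa>_nonneg by (simp add: field_simps)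
  then have "gap K \<le> 1 * exp (- (2 * K))" unfolding gap_def by (intro mult_right_mono) auto
  also have "\<dots> < 1" using K by simp
  finally show "gap K < 1" .
qed

text \<open>Subtracting a constant v keeps the \<open>K\<close>-inequality if v (exp (K t) - 1)
  \<le> (exp (K t) - exp (K' t)) s, with t the distance and s the value at \<open>q\<close>. Both
  sides vanish linearly at t = 0; a linear upper bound on the left and a linear lower bound on the
  right reduce this to the definition of \<open>gap\<close>.\<close>

lemma log_cone_subtract_mass:
  assumes K: "c + \<kappa> * K < K" and f: "f \<in> log_cone M d (c + \<kappa> * K)"
    and m: "(\<integral>\<^sup>+p. f p \<partial>M) = ennreal m" "0 \<le> m"
  shows "(\<lambda>p. f p - ennreal (gap K * m)) \<in> log_cone M d K"
    and "\<And>p. p \<in> space M \<Longrightarrow> ennreal (gap K * m) \<le> f p"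
proof -
  note [measurable] = log_cone_measurable[OF f]
  define K' where "K' = c + \<kappa> * K"
  have K0: "0 < K" and g0: "0 < gap K" using gap_bounds[OF K] by auto
  have K': "0 \<le> K'" "K' < K" using K c_nonneg \<kappa>_nonneg K0 by (auto simp: K'_def)
  have f': "f \<in> log_cone M d K'" using f by (simp add: K'_def)
  \<comment> \<open>Finite representatives, so that the estimate can be carried out with real
    subtraction.\<close>
  have real: "\<exists>r. f p = ennreal r \<and> exp (-K) * m \<le> r" if p: "p \<in> space M" for p
  proof -
    have fin: "f p < \<top>"
      using log_cone_bounds(2)[OF f' K'(1) m(1) p] by (rule le_less_trans) simp
    have "exp (-K) * m \<le> exp (-K') * m" using K' m(2) by (intro mult_right_mono) auto
    also have "\<dots> \<le> enn2real (f p)"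
      using log_cone_bounds(1)[OF f' K'(1) m(1) p] fin
      by (metis enn2real_mono enn2real_ennreal exp_ge_zero m(2) mult_nonneg_nonneg)
    finally show ?thesis using fin by (intro exI[of _ "enn2real (f p)"]) simp
  qed
  have gK: "gap K \<le> exp (-K)"
  proof -
    have "(K - (c + \<kappa> * K)) / K \<le> 1" using K0 c_nonneg \<kappa>_nonneg by (simp add: field_simps)
    then have "gap K \<le> 1 * exp (- (2 * K))" unfolding gap_def by (intro mult_right_mono) auto
    also have "\<dots> \<le> exp (-K)" using K0 by simp
    finally show ?thesis .
  qed
  show le: "ennreal (gap K * m) \<le> f p" if p: "p \<in> space M" for p
  proof -
    from real[OF p] obtain r where r: "f p = ennreal r" "exp (-K) * m \<le> r" by blast
    have "gap K * m \<le> exp (-K) * m" using gK m(2) by (rule mult_right_mono)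
    then show ?thesis using r by (auto intro: ennreal_leI)
  qed
  show "(\<lambda>p. f p - ennreal (gap K * m)) \<in> log_cone M d K"
    unfolding log_cone_def
  proof (intro CollectI conjI ballI)
    show "(\<lambda>p. f p - ennreal (gap K * m)) \<in> borel_measurable M" by measurable
    fix p q assume pq: "p \<in> space M" "q \<in> space M"
    from real[OF pq(1)] obtain r where r: "f p = ennreal r" "exp (-K) * m \<le> r" by blast
    from real[OF pq(2)] obtain s where s: "f q = ennreal s" "exp (-K) * m \<le> s" by blast
    define t where "t = d p q"
    have t: "0 \<le> t" "t \<le> 1" using d_nonneg d_le_1[OF pq] by (auto simp: t_def)
    have s0: "0 \<le> s" using s(2) m(2) by (meson exp_ge_zero mult_nonneg_nonneg order_trans)
    have rs: "r \<le> exp (K' * t) * s"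
      using log_coneD[OF f' pq] s0 by (simp add: r s t_def ennreal_mult'[symmetric])
    have "exp (K * t) - 1 = exp (K * t) * (1 - exp (- (K * t)))"
      by (simp add: right_diff_distrib exp_add[symmetric])
    also have "\<dots> \<le> exp (K * t) * (K * t)"
      using exp_ge_add_one_self[of "- (K * t)"] by (intro mult_left_mono) auto
    also have "\<dots> \<le> exp K * (K * t)" using K0 t by (intro mult_right_mono) (auto intro: mult_left_le)
    finally have e1: "exp (K * t) - 1 \<le> exp K * (K * t)" .
    have "(K - K') * t \<le> exp ((K - K') * t) - 1" using exp_ge_add_one_self[of "(K - K') * t"] by linarith
    also have "\<dots> \<le> exp (K' * t) * (exp ((K - K') * t) - 1)"
      using K' t mult_right_mono[of 1 "exp (K' * t)" "exp ((K - K') * t) - 1"] by simp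
    also have "\<dots> = exp (K * t) - exp (K' * t)"
      by (simp add: right_diff_distrib exp_add[symmetric] algebra_simps)
    finally have e2: "(K - K') * t \<le> exp (K * t) - exp (K' * t)" .
    have "gap K * m * (exp (K * t) - 1) \<le> gap K * m * (exp K * (K * t))"
      using e1 g0 m(2) by (intro mult_left_mono) auto
    also have "\<dots> = (K - K') * t * (exp (-K) * m)"
      using K0 by (simp add: gap_def K'_def exp_minus field_simps exp_add[symmetric] flip: mult_2)
    also have "\<dots> \<le> (K - K') * t * s" using s(2) K' t by (intro mult_left_mono) auto
    also have "\<dots> \<le> (exp (K * t) - exp (K' * t)) * s" using e2 s0 by (rule mult_right_mono)
    finally have "r - gap K * m \<le> exp (K * t) * (s - gap K * m)"
      using rs by (simp add: algebra_simps)
    then show "f p - ennreal (gap K * m) \<le> ennreal (exp (K * d p q)) * (f q - ennreal (gap K * m))"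
      using g0 m(2) by (simp add: r s t_def[symmetric] ennreal_minus ennreal_mult'[symmetric] ennreal_leI)
  qed
qed

text \<open>Both images dominate the constant \<open>gap K * m\<close>; removing it leaves functions of the same
  cone with mass smaller by the factor \<open>1 - gap K\<close>, while the removed parts evolve identically.\<close>

lemma coupling:
  assumes K: "c + \<kappa> * K < K" and "f \<in> log_cone M d K" "g \<in> log_cone M d K"
    and "(\<integral>\<^sup>+p. f p \<partial>M) = ennreal m" "(\<integral>\<^sup>+p. g p \<partial>M) = ennreal m" "0 \<le> m" "p \<in> space M"
  shows "(L ^^ n) f p \<le> (L ^^ n) g p + ennreal (exp K * m * (1 - gap K) ^ n)"
  using assms(2-)
proof (induction n arbitrary: f g m p)
  case 0
  have "f p \<le> ennreal (exp K * m)"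
    using gap_bounds[OF K] log_cone_bounds(2)[OF 0(1) _ 0(3) 0(6)] by simp
  then show ?case by (simp add: add_increasing)
next
  case (Suc n)
  have K0: "0 \<le> K" "0 < gap K" "gap K < 1" using gap_bounds[OF K] by auto
  define r where "r = ennreal (gap K * m)"
  have sub: "(\<lambda>p. L u p - r) \<in> log_cone M d K \<and>
      (\<integral>\<^sup>+p. L u p - r \<partial>M) = ennreal (m * (1 - gap K)) \<and>
      (\<forall>p\<in>space M. (L ^^ Suc n) u p = (L ^^ n) (\<lambda>p. L u p - r) p + r * (L ^^ n) (\<lambda>_. 1) p)"
    if u: "u \<in> log_cone M d K" "(\<integral>\<^sup>+p. u p \<partial>M) = ennreal m" for u
  proof (intro conjI ballI)
    note [measurable] = log_cone_measurable[OF u(1)] L_measurable[OF log_cone_measurable[OF u(1)]]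
    have Lu: "L u \<in> log_cone M d (c + \<kappa> * K)" "(\<integral>\<^sup>+p. L u p \<partial>M) = ennreal m"
      using L_cone[OF K0(1) u(1)] u(2) by (auto simp: nn_integral_L)
    note S = log_cone_subtract_mass[OF K Lu \<open>0 \<le> m\<close>, folded r_def]
    show "(\<lambda>p. L u p - r) \<in> log_cone M d K" by (rule S)
    have "(\<integral>\<^sup>+p. L u p - r \<partial>M) = ennreal m - (\<integral>\<^sup>+p. r \<partial>M)"
      unfolding Lu(2)[symmetric]
      by (rule nn_integral_diff) (use S(2) in \<open>auto simp: emeasure_space_1 r_def intro!: AE_I2\<close>)
    also have "\<dots> = ennreal (m * (1 - gap K))"
      using K0 \<open>0 \<le> m\<close> by (simp add: r_def emeasure_space_1 ennreal_minus algebra_simps)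
    finally show "(\<integral>\<^sup>+p. L u p - r \<partial>M) = ennreal (m * (1 - gap K))" .
    fix p assume p: "p \<in> space M"
    have "(L ^^ Suc n) u p = (L ^^ n) (L u) p" by (simp add: funpow_swap1)
    also have "\<dots> = (L ^^ n) (\<lambda>p. (L u p - r) + r * 1) p"
      using p by (intro L_pow_cong) (auto simp: diff_add_cancel_ennreal S(2))
    finally show "(L ^^ Suc n) u p = (L ^^ n) (\<lambda>p. L u p - r) p + r * (L ^^ n) (\<lambda>_. 1) p"
      by (simp only: L_pow_linear)
  qed
  note F = sub[OF Suc.prems(1,3)] and G = sub[OF Suc.prems(2,4)]
  have "(L ^^ n) (\<lambda>p. L f p - r) p \<le> (L ^^ n) (\<lambda>p. L g p - r) p
      + ennreal (exp K * (m * (1 - gap K)) * (1 - gap K) ^ n)"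
    using F G Suc.prems(5,6) K0 by (intro Suc.IH) auto
  then have "(L ^^ n) (\<lambda>p. L f p - r) p + r * (L ^^ n) (\<lambda>_. 1) p \<le>
      ((L ^^ n) (\<lambda>p. L g p - r) p + ennreal (exp K * (m * (1 - gap K)) * (1 - gap K) ^ n))
      + r * (L ^^ n) (\<lambda>_. 1) p"
    by (rule add_right_mono)
  then show ?case using F G Suc.prems(6) by (simp add: ac_simps del: funpow.simps)
qed

section \<open>Existence of the invariant density\<close>

lemma one_in_log_cone: "0 \<le> K \<Longrightarrow> (\<lambda>_. 1) \<in> log_cone M d K"
  using log_cone_add_const[of "\<lambda>_. 0" M d K 1] d_nonneg by (auto simp: log_cone_def)

lemma L_pow_one:
  assumes K: "c + \<kappa> * K < K"
  shows "(L ^^ n) (\<lambda>_. 1) \<in> log_cone M d K" "(\<integral>\<^sup>+p. (L ^^ n) (\<lambda>_. 1) p \<partial>M) = 1"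
proof -
  have K0: "0 \<le> K" using gap_bounds[OF K] by simp
  show "(L ^^ n) (\<lambda>_. 1) \<in> log_cone M d K"
  proof (induction n)
    case 0
    show ?case using one_in_log_cone[OF K0] by simp
  next
    case (Suc n)
    have "L ((L ^^ n) (\<lambda>_. 1)) \<in> log_cone M d K"
      using K by (intro log_cone_mono[OF L_cone[OF K0 Suc]] mult_right_mono d_nonneg) auto
    then show ?case by simp
  qed
  show "(\<integral>\<^sup>+p. (L ^^ n) (\<lambda>_. 1) p \<partial>M) = 1"
    using duality_pow[of "\<lambda>_. 1" "\<lambda>_. 1" n] by (simp add: emeasure_space_1)
qed

text \<open>By coupling the iterates \<open>F n\<close> are uniformly Cauchy. Invariance follows by
  replacing the density by \<open>F n\<close>, shifting n by duality and returning, with an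
  integrated error bound for each replacement.\<close>

lemma invariant_density:
  assumes K: "c + \<kappa> * K < K"
  obtains h where "h \<in> log_cone M d K" "(\<integral>\<^sup>+p. h p \<partial>M) = 1"
    "\<And>A. A \<in> sets M \<Longrightarrow> (\<integral>\<^sup>+p. h p * indicator A (T p) \<partial>M) = (\<integral>\<^sup>+p. h p * indicator A p \<partial>M)"
proof -
  have K0: "0 \<le> K" "0 < gap K" "gap K < 1" using gap_bounds[OF K] by auto
  define F where "F n = (L ^^ n) (\<lambda>_. 1)" for n
  define \<delta> where "\<delta> n = ennreal (exp K * (1 - gap K) ^ n)" for n
  have F: "F n \<in> log_cone M d K" "(\<integral>\<^sup>+p. F n p \<partial>M) = 1" for n
    using L_pow_one[OF K] by (auto simp: F_def)
  note Fm [measurable] = log_cone_measurable[OF F(1)]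
  \<comment> \<open>Both sides are \<open>n\<close> applications of \<open>L\<close> to earlier
    iterates, which lie in the cone and have the same mass 1.\<close>
  have near: "F i p \<le> F j p + \<delta> n" if "n \<le> i" "n \<le> j" "p \<in> space M" for i j n p
  proof -
    have "(L ^^ n) (F (i - n)) p \<le> (L ^^ n) (F (j - n)) p + ennreal (exp K * 1 * (1 - gap K) ^ n)"
      using that F by (intro coupling K) auto
    then show ?thesis using that by (simp add: F_def \<delta>_def funpow_add[symmetric, THEN fun_cong, unfolded comp_def])
  qed
  \<comment> \<open>With the error added, every term is an upper bound of the limit. The infimum can
    thus replace the limit, and \<open>log_cone_INF\<close> gives cone membership and
    measurability.\<close>
  define h where "h p = (INF n. F n p + \<delta> n)" for p
  have h: "h \<in> log_cone M d K"
    unfolding h_def by (intro log_cone_INF log_cone_add_const F K0 d_nonneg)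
  note [measurable] = log_cone_measurable[OF h]
  have h_le: "h p \<le> F n p + \<delta> n" for n p unfolding h_def by (rule INF_lower) simp
  have le_h: "F n p \<le> h p + \<delta> n" if p: "p \<in> space M" for n p
  proof -
    have "F n p \<le> (INF k. (F k p + \<delta> k) + \<delta> n)"
    proof (rule INF_greatest)
      fix k
      show "F n p \<le> F k p + \<delta> k + \<delta> n"
      proof (cases "n \<le> k")
        case True
        have "F n p \<le> F k p + \<delta> n" by (rule near) (use True p in auto)
        then show ?thesis by (metis add.commute add.left_commute add_increasing zero_le)
      next
        case False
        have "F n p \<le> F k p + \<delta> k" by (rule near) (use False p in auto)
        then show ?thesis by (metis add.commute add_increasing zero_le)
      qed
    qed
    also have "\<dots> = h p + \<delta> n" unfolding h_def by (rule INF_ennreal_add_const)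
    finally show ?thesis .
  qed
  \<comment> \<open>Twice the error, since the proof of invariance passes from the density to an
    iterate and back.\<close>
  have \<delta>_small: "\<exists>n. \<delta> n + \<delta> n \<le> ennreal e" if "0 < e" for e
  proof -
    have "(\<lambda>n. 2 * (exp K * (1 - gap K) ^ n)) \<longlonglongrightarrow> 2 * (exp K * 0)"
      using K0 by (intro tendsto_mult tendsto_const LIMSEQ_power_zero) auto
    then have "eventually (\<lambda>n. 2 * (exp K * (1 - gap K) ^ n) < e) sequentially"
      using that by (intro order_tendstoD(2)) auto
    then obtain n where "2 * (exp K * (1 - gap K) ^ n) < e"
      using eventually_happens sequentially_bot by blast
    then show ?thesis
      using K0 by (intro exI[of _ n]) (auto simp: \<delta>_def ennreal_plus[symmetric] simp del: ennreal_plus intro!: ennreal_leI)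
  qed
  have int_h_le: "(\<integral>\<^sup>+p. h p * g p \<partial>M) \<le> (\<integral>\<^sup>+p. F n p * g p \<partial>M) + \<delta> n"
    and int_le_h: "(\<integral>\<^sup>+p. F n p * g p \<partial>M) \<le> (\<integral>\<^sup>+p. h p * g p \<partial>M) + \<delta> n"
    if [measurable]: "g \<in> borel_measurable M" and g1: "\<And>p. g p \<le> 1" for g :: "'a \<Rightarrow> ennreal" and n
  proof -
    have gi: "\<delta> n * (\<integral>\<^sup>+p. g p \<partial>M) \<le> \<delta> n"
    proof -
      have "(\<integral>\<^sup>+p. g p \<partial>M) \<le> (\<integral>\<^sup>+p. 1 \<partial>M)" by (intro nn_integral_mono g1)
      then show ?thesis using mult_left_mono[of _ 1 "\<delta> n"] by (simp add: emeasure_space_1)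
    qed
    have "(\<integral>\<^sup>+p. h p * g p \<partial>M) \<le> (\<integral>\<^sup>+p. F n p * g p + \<delta> n * g p \<partial>M)"
      using h_le by (intro nn_integral_mono) (auto simp: distrib_right[symmetric] intro!: mult_right_mono)
    also have "\<dots> = (\<integral>\<^sup>+p. F n p * g p \<partial>M) + \<delta> n * (\<integral>\<^sup>+p. g p \<partial>M)"
      by (simp add: nn_integral_add nn_integral_cmult)
    finally show "(\<integral>\<^sup>+p. h p * g p \<partial>M) \<le> (\<integral>\<^sup>+p. F n p * g p \<partial>M) + \<delta> n"
      using gi by (meson add_left_mono order_trans)
    have "(\<integral>\<^sup>+p. F n p * g p \<partial>M) \<le> (\<integral>\<^sup>+p. h p * g p + \<delta> n * g p \<partial>M)"
      using le_h by (intro nn_integral_mono) (auto simp: distrib_right[symmetric] intro!: mult_right_mono)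
    also have "\<dots> = (\<integral>\<^sup>+p. h p * g p \<partial>M) + \<delta> n * (\<integral>\<^sup>+p. g p \<partial>M)"
      by (simp add: nn_integral_add nn_integral_cmult)
    finally show "(\<integral>\<^sup>+p. F n p * g p \<partial>M) \<le> (\<integral>\<^sup>+p. h p * g p \<partial>M) + \<delta> n"
      using gi by (meson add_left_mono order_trans)
  qed
  have \<delta>_Suc: "\<delta> (Suc n) \<le> \<delta> n" for n
    using K0 by (auto simp: \<delta>_def intro!: ennreal_leI mult_left_mono power_decreasing)
  have \<delta>_le: "\<delta> n \<le> \<delta> n + \<delta> n" for n by (simp add: add_increasing)
  show ?thesis
  proof (rule that[OF h])
    show "(\<integral>\<^sup>+p. h p \<partial>M) = 1"
    proof (rule antisym; rule ennreal_le_epsilon)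
      fix e :: real assume "0 < e"
      from \<delta>_small[OF this] obtain n where n: "\<delta> n + \<delta> n \<le> ennreal e" ..
      with \<delta>_le[of n] have "\<delta> n \<le> ennreal e" by (rule order_trans)
      note add_left_mono[OF this]
      note le = order_trans[OF _ this]
      have "(\<integral>\<^sup>+p. h p \<partial>M) \<le> 1 + \<delta> n" "1 \<le> (\<integral>\<^sup>+p. h p \<partial>M) + \<delta> n"
        using int_h_le[of "\<lambda>_. 1" n] int_le_h[of "\<lambda>_. 1" n] F(2)[of n] by simp_all
      from this[THEN le] show "(\<integral>\<^sup>+p. h p \<partial>M) \<le> 1 + ennreal e" "1 \<le> (\<integral>\<^sup>+p. h p \<partial>M) + ennreal e"
        by simp_all
    qed
    fix A assume A[measurable]: "A \<in> sets M"
    let ?I = "indicator A :: 'a \<Rightarrow> ennreal"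
    \<comment> \<open>Duality trades the \<open>T\<close> in the test function for one more
      iterate.\<close>
    have shift: "(\<integral>\<^sup>+p. F n p * ?I (T p) \<partial>M) = (\<integral>\<^sup>+p. F (Suc n) p * ?I p \<partial>M)" for n
      unfolding F_def funpow.simps(2) comp_apply
      by (rule duality) (auto simp: F_def[symmetric])
    have I1: "?I p \<le> 1" for p by (simp add: indicator_def)
    show "(\<integral>\<^sup>+p. h p * ?I (T p) \<partial>M) = (\<integral>\<^sup>+p. h p * ?I p \<partial>M)"
    proof (rule antisym)
      show "(\<integral>\<^sup>+p. h p * ?I (T p) \<partial>M) \<le> (\<integral>\<^sup>+p. h p * ?I p \<partial>M)"
      proof (rule ennreal_le_epsilon)
        fix e :: real assume "0 < e"
        from \<delta>_small[OF this] obtain n where n: "\<delta> n + \<delta> n \<le> ennreal e" ..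
        have "(\<integral>\<^sup>+p. h p * ?I (T p) \<partial>M) \<le> (\<integral>\<^sup>+p. F (Suc n) p * ?I p \<partial>M) + \<delta> n"
          using int_h_le[of "\<lambda>p. ?I (T p)" n] I1 by (simp add: shift)
        also have "\<dots> \<le> ((\<integral>\<^sup>+p. h p * ?I p \<partial>M) + \<delta> n) + \<delta> n"
          using int_le_h[of ?I "Suc n"] I1 \<delta>_Suc[of n]
          by (intro add_right_mono) (auto intro: add_left_mono order_trans)
        also have "\<dots> \<le> (\<integral>\<^sup>+p. h p * ?I p \<partial>M) + ennreal e"
          unfolding add.assoc by (intro add_left_mono n)
        finally show "(\<integral>\<^sup>+p. h p * ?I (T p) \<partial>M) \<le> (\<integral>\<^sup>+p. h p * ?I p \<partial>M) + ennreal e" .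
      qed
      show "(\<integral>\<^sup>+p. h p * ?I p \<partial>M) \<le> (\<integral>\<^sup>+p. h p * ?I (T p) \<partial>M)"
      proof (rule ennreal_le_epsilon)
        fix e :: real assume "0 < e"
        from \<delta>_small[OF this] obtain n where n: "\<delta> n + \<delta> n \<le> ennreal e" ..
        have "(\<integral>\<^sup>+p. h p * ?I p \<partial>M) \<le> (\<integral>\<^sup>+p. F n p * ?I (T p) \<partial>M) + \<delta> n"
          using int_h_le[of ?I "Suc n"] I1 \<delta>_Suc[of n] by (auto simp: shift intro: add_left_mono order_trans)
        also have "\<dots> \<le> ((\<integral>\<^sup>+p. h p * ?I (T p) \<partial>M) + \<delta> n) + \<delta> n"
          using int_le_h[of "\<lambda>p. ?I (T p)" n] I1 by (intro add_right_mono) auto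
        also have "\<dots> \<le> (\<integral>\<^sup>+p. h p * ?I (T p) \<partial>M) + ennreal e"
          unfolding add.assoc by (intro add_left_mono n)
        finally show "(\<integral>\<^sup>+p. h p * ?I p \<partial>M) \<le> (\<integral>\<^sup>+p. h p * ?I (T p) \<partial>M) + ennreal e" .
      qed
    qed
  qed
qed

text \<open>Duality moves the iterate of \<open>T\<close> onto \<open>f\<close> and
  \<open>g\<close>, where \<open>coupling\<close> applies pointwise, and then back again. The bound
  is one-sided because differences in \<open>ennreal\<close> truncate; exchanging \<open>f\<close>
  and \<open>g\<close> gives the other side.\<close>

lemma nn_integral_correlation:
  assumes K: "c + \<kappa> * K < K" and f: "f \<in> log_cone M d K" and g: "g \<in> log_cone M d K"
    and m: "(\<integral>\<^sup>+p. f p \<partial>M) = ennreal m" "(\<integral>\<^sup>+p. g p \<partial>M) = ennreal m" "0 \<le> m"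
    and u: "u \<in> borel_measurable M" "(\<integral>\<^sup>+p. u p \<partial>M) \<le> ennreal B"
  shows "(\<integral>\<^sup>+p. f p * u ((T ^^ n) p) \<partial>M)
    \<le> (\<integral>\<^sup>+p. g p * u ((T ^^ n) p) \<partial>M) + ennreal (exp K * m * (1 - gap K) ^ n * B)"
proof -
  note [measurable] = u(1) L_pow_measurable[OF log_cone_measurable[OF f]]
    L_pow_measurable[OF log_cone_measurable[OF g]]
  have K0: "0 \<le> K" "0 < gap K" "gap K < 1" using gap_bounds[OF K] by auto
  let ?e = "ennreal (exp K * m * (1 - gap K) ^ n)"
  have "(\<integral>\<^sup>+p. f p * u ((T ^^ n) p) \<partial>M) = (\<integral>\<^sup>+p. (L ^^ n) f p * u p \<partial>M)"
    by (rule duality_pow[OF log_cone_measurable[OF f] u(1)])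
  also have "\<dots> \<le> (\<integral>\<^sup>+p. (L ^^ n) g p * u p + ?e * u p \<partial>M)"
    using coupling[OF K f g m]
    by (intro nn_integral_mono) (auto simp: distrib_right[symmetric] intro!: mult_right_mono)
  also have "\<dots> = (\<integral>\<^sup>+p. (L ^^ n) g p * u p \<partial>M) + ?e * (\<integral>\<^sup>+p. u p \<partial>M)"
    by (simp add: nn_integral_add nn_integral_cmult)
  also have "\<dots> \<le> (\<integral>\<^sup>+p. (L ^^ n) g p * u p \<partial>M) + ?e * ennreal B"
    by (intro add_left_mono mult_left_mono u(2)) auto
  also have "?e * ennreal B = ennreal (exp K * m * (1 - gap K) ^ n * B)"
    using K0 m(3) by (subst ennreal_mult') auto
  also have "(\<integral>\<^sup>+p. (L ^^ n) g p * u p \<partial>M) = (\<integral>\<^sup>+p. g p * u ((T ^^ n) p) \<partial>M)"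
    by (rule duality_pow[OF log_cone_measurable[OF g] u(1), symmetric])
  finally show ?thesis .
qed

end

section \<open>Correlations under the invariant measure\<close>

lemma prob_space_density:
  "h \<in> borel_measurable M \<Longrightarrow> (\<integral>\<^sup>+p. h p \<partial>M) = 1 \<Longrightarrow> prob_space (density M h)"
  by (rule prob_spaceI) (simp add: emeasure_density cong: nn_integral_cong)

lemma measure_preserving_distr_pow:
  assumes "measure_preserving M T"
  shows "T ^^ n \<in> measurable M M" "distr M M (T ^^ n) = M"
proof -
  have T [measurable]: "T \<in> measurable M M" using assms by (simp add: measure_preserving_def)
  have 1: "distr M M T = M"
    using assms by (intro measure_eqI) (auto simp: emeasure_distr measure_preserving_def)
  show Tn [measurable]: "T ^^ n \<in> measurable M M" for n
    by (induction n) (auto simp: comp_def intro: measurable_compose)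
  show "distr M M (T ^^ n) = M"
  proof (induction n)
    case 0
    show ?case by (simp add: distr_id2)
  next
    case (Suc n)
    have "distr M M (T ^^ Suc n) = distr (distr M M (T ^^ n)) M T"
      by (subst distr_distr) simp_all
    then show ?case by (simp add: Suc 1 comp_def)
  qed
qed

context contracting_transfer
begin

lemma density_preserved:
  assumes h [measurable]: "h \<in> borel_measurable M"
    and inv: "\<And>A. A \<in> sets M \<Longrightarrow>
      (\<integral>\<^sup>+p. h p * indicator A (T p) \<partial>M) = (\<integral>\<^sup>+p. h p * indicator A p \<partial>M)"
  shows "measure_preserving (density M h) T"
  unfolding measure_preserving_def
proof (intro conjI ballI)
  show "T \<in> measurable (density M h) (density M h)" by simp
  fix A assume "A \<in> sets (density M h)"
  then have A [measurable]: "A \<in> sets M" by simp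
  have "emeasure (density M h) (T -` A \<inter> space M) = (\<integral>\<^sup>+p. h p * indicator (T -` A \<inter> space M) p \<partial>M)"
    by (intro emeasure_density) measurable
  also have "\<dots> = (\<integral>\<^sup>+p. h p * indicator A (T p) \<partial>M)"
    by (intro nn_integral_cong) (auto simp: indicator_def)
  also have "\<dots> = emeasure (density M h) A" by (simp add: inv emeasure_density)
  finally show "emeasure (density M h) (T -` A \<inter> space (density M h)) = emeasure (density M h) A" by simp
qed

text \<open>Let m be the mean of \<open>\<phi>\<close>. By invariance the product of the two means
  is the integral of \<open>\<psi>\<close> after n steps against m h. The correlation therefore
  compares the cone functions \<open>\<phi>\<close> h and m h, which have the same mass m, and
  \<open>nn_integral_correlation\<close> applies in both directions.\<close>

lemma correlation_bound:
  fixes \<phi> \<psi> :: "'a \<Rightarrow> real"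
  assumes K: "c + \<kappa> * K < K"
    and h: "h \<in> log_cone M d K" and h_int: "(\<integral>\<^sup>+p. h p \<partial>M) = 1"
    and pres: "measure_preserving (density M h) T"
    and \<phi>: "(\<lambda>p. ennreal (\<phi> p) * h p) \<in> log_cone M d K"
    and \<phi>_m [measurable]: "\<phi> \<in> borel_measurable M"
    and \<phi>_bound: "\<And>p. p \<in> space M \<Longrightarrow> 0 \<le> \<phi> p \<and> \<phi> p \<le> R"
    and \<psi> [measurable]: "\<psi> \<in> borel_measurable M" and \<psi>_bound: "\<And>p. 0 \<le> \<psi> p \<and> \<psi> p \<le> B"
  defines "\<mu> \<equiv> density M h"
  shows "\<bar>(LINT p|\<mu>. \<phi> p * \<psi> ((T ^^ n) p)) - (LINT p|\<mu>. \<phi> p) * (LINT p|\<mu>. \<psi> p)\<bar>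
    \<le> exp K * R * (1 - gap K) ^ n * B"
proof -
  note [measurable] = log_cone_measurable[OF h]
  have K0: "0 \<le> K" "0 < gap K" "gap K < 1" using gap_bounds[OF K] by auto
  interpret \<mu>: prob_space \<mu>
    unfolding \<mu>_def using h_int by (intro prob_space_density) simp_all
  have [simp]: "space \<mu> = space M" "sets \<mu> = sets M" by (simp_all add: \<mu>_def)
  have [measurable_cong]: "sets \<mu> = sets M" by simp
  obtain p0 where "p0 \<in> space M" using not_empty by blast
  then have R: "0 \<le> R" and B: "0 \<le> B" using \<phi>_bound \<psi>_bound by (meson order_trans)+
  have nn\<mu>: "(\<integral>\<^sup>+p. u p \<partial>\<mu>) = (\<integral>\<^sup>+p. h p * u p \<partial>M)" if "u \<in> borel_measurable M" for u :: "'a \<Rightarrow> ennreal"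
    unfolding \<mu>_def using that by (intro nn_integral_density) simp_all
  define m where "m = (LINT p|\<mu>. \<phi> p)"
  define s where "s = (LINT p|\<mu>. \<psi> p)"
  define x where "x = (LINT p|\<mu>. \<phi> p * \<psi> ((T ^^ n) p))"
  let ?e = "exp K * m * (1 - gap K) ^ n * B"
  have int\<phi>: "integrable \<mu> \<phi>"
    by (rule \<mu>.integrable_const_bound[where B = R]) (use \<phi>_bound in auto)
  have m_nn: "0 \<le> m" unfolding m_def by (rule Bochner_Integration.integral_nonneg) (use \<phi>_bound in auto)
  have s_nn: "0 \<le> s" unfolding s_def by (rule Bochner_Integration.integral_nonneg) (use \<psi>_bound in auto)
  have m_R: "m \<le> R" unfolding m_def by (rule \<mu>.integral_le_const[OF int\<phi>]) (use \<phi>_bound in auto)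
  have m_eq: "(\<integral>\<^sup>+p. ennreal (\<phi> p) \<partial>\<mu>) = ennreal m"
    unfolding m_def by (rule nn_integral_eq_integral[OF int\<phi>]) (use \<phi>_bound in auto)
  have s_eq: "(\<integral>\<^sup>+p. ennreal (\<psi> p) \<partial>\<mu>) = ennreal s"
    unfolding s_def by (rule nn_integral_eq_integral)
      (use \<psi>_bound in \<open>auto intro!: \<mu>.integrable_const_bound[where B = B]\<close>)
  have int\<phi>\<psi>: "integrable \<mu> (\<lambda>p. \<phi> p * \<psi> ((T ^^ n) p))"
    by (rule \<mu>.integrable_const_bound[where B = "R * B"])
      (use \<phi>_bound \<psi>_bound R in \<open>auto simp: abs_mult intro!: mult_mono\<close>)
  have x_nn: "0 \<le> x" unfolding x_def by (rule Bochner_Integration.integral_nonneg) (use \<phi>_bound \<psi>_bound in auto)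
  have x_eq: "(\<integral>\<^sup>+p. ennreal (\<phi> p * \<psi> ((T ^^ n) p)) \<partial>\<mu>) = ennreal x"
    unfolding x_def by (rule nn_integral_eq_integral[OF int\<phi>\<psi>]) (use \<phi>_bound \<psi>_bound in auto)
  have x_eq': "(\<integral>\<^sup>+p. (ennreal (\<phi> p) * h p) * ennreal (\<psi> ((T ^^ n) p)) \<partial>M) = ennreal x"
    unfolding x_eq[symmetric] using \<phi>_bound \<psi>_bound
    by (subst nn\<mu>) (auto intro!: nn_integral_cong simp: ennreal_mult' mult_ac)
  have "(\<integral>\<^sup>+p. ennreal (\<psi> ((T ^^ n) p)) \<partial>\<mu>) = (\<integral>\<^sup>+p. ennreal (\<psi> p) \<partial>distr \<mu> \<mu> (T ^^ n))"
    by (subst nn_integral_distr) simp_all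
  also have "\<dots> = ennreal s"
    using measure_preserving_distr_pow(2)[OF pres] by (simp add: \<mu>_def[symmetric] s_eq)
  finally have "ennreal m * (\<integral>\<^sup>+p. h p * ennreal (\<psi> ((T ^^ n) p)) \<partial>M) = ennreal m * ennreal s"
    by (subst (asm) nn\<mu>) simp_all
  then have ms_eq: "(\<integral>\<^sup>+p. (ennreal m * h p) * ennreal (\<psi> ((T ^^ n) p)) \<partial>M) = ennreal (m * s)"
    using m_nn by (simp add: nn_integral_cmult mult.assoc ennreal_mult')
  have f_int: "(\<integral>\<^sup>+p. ennreal (\<phi> p) * h p \<partial>M) = ennreal m"
    unfolding m_eq[symmetric] by (subst nn\<mu>) (simp_all add: mult.commute)
  have g: "(\<lambda>p. ennreal m * h p) \<in> log_cone M d K" "(\<integral>\<^sup>+p. ennreal m * h p \<partial>M) = ennreal m"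
    using log_cone_const_mult[OF h] by (simp_all add: nn_integral_cmult h_int)
  have \<psi>_int: "(\<integral>\<^sup>+p. ennreal (\<psi> p) \<partial>M) \<le> ennreal B"
  proof -
    have "(\<integral>\<^sup>+p. ennreal (\<psi> p) \<partial>M) \<le> (\<integral>\<^sup>+p. ennreal B \<partial>M)"
      using \<psi>_bound by (intro nn_integral_mono ennreal_leI) auto
    then show ?thesis by (simp add: emeasure_space_1)
  qed
  have e_nn: "0 \<le> ?e" using m_nn K0 B by simp
  have \<psi>': "(\<lambda>p. ennreal (\<psi> p)) \<in> borel_measurable M" by simp
  have "x \<le> m * s + ?e"
    using nn_integral_correlation[OF K \<phi> g(1) f_int g(2) m_nn \<psi>' \<psi>_int, of n] m_nn s_nn e_nn
    by (simp add: x_eq' ms_eq ennreal_plus[symmetric] del: ennreal_plus)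
  moreover have "m * s \<le> x + ?e"
    using nn_integral_correlation[OF K g(1) \<phi> g(2) f_int m_nn \<psi>' \<psi>_int, of n] x_nn e_nn
    by (simp add: x_eq' ms_eq ennreal_plus[symmetric] del: ennreal_plus)
  moreover have "?e \<le> exp K * R * (1 - gap K) ^ n * B"
    using m_R K0 B by (intro mult_right_mono mult_left_mono) auto
  ultimately have "\<bar>x - m * s\<bar> \<le> exp K * R * (1 - gap K) ^ n * B" by linarith
  then show ?thesis by (simp add: x_def m_def s_def)
qed

end

section \<open>Ergodicity from mixing\<close>

text \<open>For an invariant set \<open>A\<close> the correlation of a function with the indicator
  of \<open>A\<close> does not change with n, so its decay forces it to be 0. The indicator of
  \<open>A\<close> itself need not be Hoelder; the identity is therefore proved for Lipschitz
  functions and carried over to Borel sets. Taking the Borel set to cut out \<open>A\<close> gives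
  prob A = (prob A)^2.\<close>

lemma exponentially_mixing_imp_ergodic:
  fixes M :: "'a::metric_space measure"
  assumes "prob_space M" and sets_M: "sets M = sets (restrict_space borel X)"
    and mix: "exponentially_mixing M T"
  shows "ergodic M T"
proof -
  interpret prob_space M by fact
  have mp: "measure_preserving M T" using mix by (simp add: exponentially_mixing_def)
  have Tm: "T \<in> measurable M M" using mp by (simp add: measure_preserving_def)
  have id_m [measurable]: "(\<lambda>x. x) \<in> measurable M borel"
    using measurable_restrict_space1[of "\<lambda>x. x" borel borel X]
    by (simp add: measurable_cong_sets[OF sets_M refl])
  from mix have "\<exists>C \<theta>. 0 < \<theta> \<and> \<theta> < 1 \<and>
         (\<forall>(\<phi> :: 'a \<Rightarrow> real) (\<psi> :: 'a \<Rightarrow> real) S H B.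
            (\<forall>p\<in>space M. \<bar>\<phi> p\<bar> \<le> S) \<longrightarrow>
            (\<forall>p\<in>space M. \<forall>q\<in>space M. \<bar>\<phi> p - \<phi> q\<bar> \<le> H * dist p q powr 1) \<longrightarrow>
            \<psi> \<in> borel_measurable M \<longrightarrow>
            (AE p in M. \<bar>\<psi> p\<bar> \<le> B) \<longrightarrow>
            (\<forall>n. \<bar>(LINT p|M. \<phi> p * \<psi> ((T ^^ n) p)) - (LINT p|M. \<phi> p) * (LINT p|M. \<psi> p)\<bar>
                   \<le> C * \<theta> ^ n * (S + H) * B))"
    \<comment> \<open>The test functions below are Lipschitz, hence exponent 1.\<close>
    unfolding exponentially_mixing_def by (elim conjE allE[of _ 1] mp) simp
  then obtain C \<theta> where \<theta>: "0 < \<theta>" "\<theta> < 1" and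
    corr: "\<And>\<phi> \<psi> S H B n. (\<forall>p\<in>space M. \<bar>\<phi> p\<bar> \<le> S) \<Longrightarrow>
            (\<forall>p\<in>space M. \<forall>q\<in>space M. \<bar>\<phi> p - \<phi> q\<bar> \<le> H * dist p q powr 1) \<Longrightarrow>
            \<psi> \<in> borel_measurable M \<Longrightarrow>
            (AE p in M. \<bar>\<psi> p\<bar> \<le> B) \<Longrightarrow>
            \<bar>(LINT p|M. \<phi> p * \<psi> ((T ^^ n) p)) - (LINT p|M. \<phi> p) * (LINT p|M. \<psi> p)\<bar>
                   \<le> C * \<theta> ^ n * (S + H) * B"
    by blast
  have zero_one: "prob A = 0 \<or> prob A = 1"
    if A [measurable]: "A \<in> sets M" and inv: "T -` A \<inter> space M = A" for A
  proof -
    have inv_pow: "(T ^^ n) p \<in> space M \<and> ((T ^^ n) p \<in> A \<longleftrightarrow> p \<in> A)" if "p \<in> space M" for p n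
      using that by (induction n) (use inv measurable_space[OF Tm] in auto)
    have closed: "prob (A \<inter> F) = prob A * prob (F \<inter> space M)" if F: "closed F" for F
    \<comment> \<open>\<open>infdist p {}\<close> is 0 by convention, so the empty set is treated
      apart.\<close>
    proof (cases "F = {}")
      case False
      have [measurable]: "F \<in> sets borel" using F by simp
      have Fs [measurable]: "F \<inter> space M \<in> sets M"
        using measurable_sets[OF id_m, of F] by simp
      \<comment> \<open>Lipschitz with constant k, equal to 1 on \<open>F\<close> and to 0 at
        distance at least 1/k (for k > 0). The pointwise limit is the indicator of \<open>F\<close>
        because \<open>F\<close> is closed.\<close>
      define \<phi> where "\<phi> k p = max 0 (1 - real k * infdist p F)" for k p
      have \<phi>_m [measurable]: "\<phi> k \<in> borel_measurable M" for k
      proof -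
        have "\<phi> k \<in> borel_measurable borel"
          unfolding \<phi>_def by (intro borel_measurable_continuous_onI continuous_intros)
        from measurable_compose[OF id_m this] show ?thesis by simp
      qed
      have \<phi>_bound: "0 \<le> \<phi> k p" "\<phi> k p \<le> 1" for k p
        by (auto simp: \<phi>_def infdist_nonneg)
      have \<phi>_lip: "\<bar>\<phi> k p - \<phi> k q\<bar> \<le> real k * dist p q powr 1" for k p q
      proof -
        have "\<bar>\<phi> k p - \<phi> k q\<bar> \<le> \<bar>real k * infdist p F - real k * infdist q F\<bar>"
          by (auto simp: \<phi>_def)
        also have "\<dots> = real k * \<bar>infdist p F - infdist q F\<bar>"
          by (simp add: abs_mult right_diff_distrib[symmetric])
        also have "\<dots> \<le> real k * dist p q"
          by (intro mult_left_mono infdist_triangle_abs) auto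
        finally show ?thesis by simp
      qed
      have \<phi>_lim: "(\<lambda>k. \<phi> k p) \<longlonglongrightarrow> indicator F p" for p
      proof (cases "p \<in> F")
        case True
        then show ?thesis by (simp add: \<phi>_def)
      next
        case p: False
        then have pos: "0 < infdist p F"
          using in_closed_iff_infdist_zero[OF F False] infdist_nonneg[of p F] by force
        have "eventually (\<lambda>k. \<phi> k p = 0) sequentially"
        proof -
          have "eventually (\<lambda>k. 1 / infdist p F \<le> real k) sequentially"
            by real_asymp
          then show ?thesis
            by eventually_elim (use pos in \<open>simp add: \<phi>_def field_simps\<close>)
        qed
        then show ?thesis using p by (simp add: tendsto_eventually)
      qed
      have eq: "(LINT p|M. \<phi> k p * indicator A p) = (LINT p|M. \<phi> k p) * prob A" for k
      proof -
        let ?D = "\<bar>(LINT p|M. \<phi> k p * indicator A p) - (LINT p|M. \<phi> k p) * prob A\<bar>"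
        have bound: "?D \<le> C * \<theta> ^ n * (1 + real k) * 1" for n
        proof -
          have "(LINT p|M. \<phi> k p * indicator A ((T ^^ n) p)) = (LINT p|M. \<phi> k p * indicator A p)"
            by (intro Bochner_Integration.integral_cong) (auto simp: inv_pow indicator_def)
          then show ?thesis
            using corr[of "\<phi> k" 1 "real k" "indicator A" 1 n] \<phi>_bound \<phi>_lip by simp
        qed
        have "(\<lambda>n. C * \<theta> ^ n * (1 + real k) * 1) \<longlonglongrightarrow> C * 0 * (1 + real k) * 1"
          using \<theta> by (intro tendsto_mult tendsto_const LIMSEQ_power_zero) auto
        then have "?D \<le> C * 0 * (1 + real k) * 1"
          by (rule LIMSEQ_le_const) (use bound in blast)
        then show ?thesis by simp
      qed
      have "(\<lambda>k. LINT p|M. \<phi> k p * indicator A p) \<longlonglongrightarrow> (LINT p|M. indicator F p * indicator A p)"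
      proof (rule integral_dominated_convergence[where w = "\<lambda>_. 1"])
        show "(\<lambda>p. indicator F p * indicator A p :: real) \<in> borel_measurable M"
          using measurable_compose[OF id_m, of "indicator F :: _ \<Rightarrow> real" borel] by simp
        show "AE p in M. (\<lambda>k. \<phi> k p * indicator A p) \<longlonglongrightarrow> indicator F p * indicator A p"
          by (intro AE_I2 tendsto_mult \<phi>_lim tendsto_const)
        show "AE p in M. norm (\<phi> k p * indicator A p) \<le> 1" for k
          using \<phi>_bound by (auto simp: indicator_def)
      qed simp_all
      also have "(LINT p|M. indicator F p * indicator A p) = (LINT p|M. indicator (A \<inter> F) p :: real)"
        by (intro Bochner_Integration.integral_cong) (auto simp: indicator_def)
      also have "\<dots> = prob (A \<inter> F)"
      proof -
        have "A \<inter> F = A \<inter> (F \<inter> space M)" using sets.sets_into_space[OF A] by auto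
        then have "A \<inter> F \<in> sets M" by simp
        then show ?thesis by simp
      qed
      finally have l1: "(\<lambda>k. (LINT p|M. \<phi> k p) * prob A) \<longlonglongrightarrow> prob (A \<inter> F)" by (simp add: eq)
      have "(\<lambda>k. LINT p|M. \<phi> k p) \<longlonglongrightarrow> (LINT p|M. indicator F p)"
      proof (rule integral_dominated_convergence[where w = "\<lambda>_. 1"])
        show "(indicator F :: _ \<Rightarrow> real) \<in> borel_measurable M"
          using measurable_compose[OF id_m, of "indicator F :: _ \<Rightarrow> real" borel] by simp
        show "AE p in M. (\<lambda>k. \<phi> k p) \<longlonglongrightarrow> indicator F p"
          by (intro AE_I2 \<phi>_lim)
        show "AE p in M. norm (\<phi> k p) \<le> 1" for k using \<phi>_bound by auto
      qed simp_all
      also have "(LINT p|M. indicator F p :: real) = prob (F \<inter> space M)" by simp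
      finally have "(\<lambda>k. (LINT p|M. \<phi> k p) * prob A) \<longlonglongrightarrow> prob (F \<inter> space M) * prob A"
        by (intro tendsto_mult tendsto_const)
      from LIMSEQ_unique[OF l1 this] show ?thesis by simp
    qed simp
    \<comment> \<open>Both measures are pushed to the whole type, where the closed sets form a
      generator stable under intersection; \<open>UNIV\<close> is closed and of finite
      measure.\<close>
    define N where "N = distr (density M (indicator A)) borel (\<lambda>x. x)"
    define N' where "N' = distr (density M (\<lambda>_. ennreal (prob A))) borel (\<lambda>x. x)"
    have id_s: "B \<inter> space M \<in> sets M" if "B \<in> sets borel" for B
      using measurable_sets[OF id_m that] by simp
    have N: "emeasure N B = ennreal (prob (A \<inter> B))" if B: "B \<in> sets borel" for B
    proof -
      have "A \<inter> B = A \<inter> (B \<inter> space M)" using sets.sets_into_space[OF A] by auto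
      moreover have "emeasure N B = emeasure (density M (indicator A)) (B \<inter> space M)"
        unfolding N_def using B by (subst emeasure_distr) simp_all
      moreover have "emeasure (density M (indicator A)) S = emeasure M (A \<inter> S)"
        if [measurable]: "S \<in> sets M" for S
        by (simp add: emeasure_density indicator_inter_arith[symmetric])
      note this[OF id_s[OF B]]
      ultimately show ?thesis by (simp add: emeasure_eq_measure)
    qed
    have N': "emeasure N' B = ennreal (prob A * prob (B \<inter> space M))" if B: "B \<in> sets borel" for B
    proof -
      have "emeasure N' B = emeasure (density M (\<lambda>_. ennreal (prob A))) (B \<inter> space M)"
        unfolding N'_def using B by (subst emeasure_distr) simp_all
      also have "\<dots> = ennreal (prob A) * emeasure M (B \<inter> space M)"
        using id_s[OF B] by (simp add: emeasure_density nn_integral_cmult_indicator)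
      finally show ?thesis by (simp add: emeasure_eq_measure ennreal_mult')
    qed
    have "N = N'"
    proof (rule measure_eqI_generator_eq[where E = "Collect closed" and \<Omega> = UNIV and A = "\<lambda>_. UNIV"])
      show "Int_stable (Collect (closed :: 'a set \<Rightarrow> bool))" by (auto simp: Int_stable_def)
      show "emeasure N F = emeasure N' F" if "F \<in> Collect closed" for F
        using that closed[of F] N[of F] N'[of F] by simp
      show "sets N = sigma_sets UNIV (Collect closed)" "sets N' = sigma_sets UNIV (Collect closed)"
        by (simp_all add: N_def N'_def borel_eq_closed)
      show "emeasure N UNIV \<noteq> \<infinity>" by (simp add: N)
    qed auto
    \<comment> \<open>A measurable set of \<open>M\<close> is the trace of a Borel set
      \<open>B\<close>; evaluating both measures at this \<open>B\<close> tests \<open>A\<close>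
      against itself.\<close>
    moreover obtain B where B: "B \<in> sets borel" "A = X \<inter> B"
      using A by (auto simp: sets_M sets_restrict_space)
    moreover have "space M = X" using sets_eq_imp_space_eq[OF sets_M] by (simp add: space_restrict_space)
    ultimately have "ennreal (prob A) = ennreal (prob A * prob A)"
      using N[OF B(1)] N'[OF B(1)] by (simp add: Int_commute Int_left_absorb)
    then have "prob A * (1 - prob A) = 0" by (simp add: algebra_simps)
    then show ?thesis by auto
  qed
  show ?thesis
    unfolding ergodic_def
  proof (intro conjI mp ballI impI)
    fix A assume A: "A \<in> sets M" "T -` A \<inter> space M = A"
    from zero_one[OF A] show "emeasure M A = 0 \<or> emeasure M (space M - A) = 0"
      using prob_compl[OF A(1)] by (auto simp: emeasure_eq_measure)
  qed
qed

section \<open>The transfer operator of the proper continued fraction map\<close>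

text \<open>With a = j + 1 and b = j + 1 + k, the pairs b \<ge> a \<ge> 1 are enumerated by
  unrestricted naturals.\<close>

definition branch :: "nat \<Rightarrow> nat \<Rightarrow> real \<times> real \<Rightarrow> real \<times> real" where
  "branch j k p = (real (Suc j) / (real (Suc j + k) + fst p), 1 / (real (Suc j) + snd p))"

text \<open>The derivative of a branch is diagonal, since each coordinate of the image depends only
  on the same coordinate of the argument; this is the absolute value of its determinant.\<close>

definition branch_jacobian :: "nat \<Rightarrow> nat \<Rightarrow> real \<times> real \<Rightarrow> real" where
  "branch_jacobian j k p =
     1 / (real (Suc j) + snd p)\<^sup>2 * (real (Suc j) / (real (Suc j + k) + fst p)\<^sup>2)"

text \<open>The sum over the digit a is outermost, because a is read off from the second coordinate
  and selects the family of branches for the first.\<close>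

definition transfer :: "(real \<times> real \<Rightarrow> ennreal) \<Rightarrow> real \<times> real \<Rightarrow> ennreal" where
  "transfer f p = (\<Sum>j. \<Sum>k. ennreal (branch_jacobian j k p) * f (branch j k p))"

definition log_dist :: "real \<times> real \<Rightarrow> real \<times> real \<Rightarrow> real" where
  "log_dist p q = max \<bar>ln (1 + fst p) - ln (1 + fst q)\<bar> \<bar>ln (1 + snd p) - ln (1 + snd q)\<bar>"

abbreviation square_measure :: "(real \<times> real) measure" where
  "square_measure \<equiv> restrict_space lborel unit_square"

section \<open>Branches and measurability on the square\<close>

lemma unit_square_iff: "p \<in> unit_square \<longleftrightarrow> 0 \<le> fst p \<and> fst p \<le> 1 \<and> 0 \<le> snd p \<and> snd p \<le> 1"
  by (auto simp: unit_square_def mem_Times_iff)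

lemma unit_square_borel [measurable]: "unit_square \<in> sets borel"
  unfolding unit_square_def by (intro borel_closed closed_Times) auto

lemma space_square [simp]: "space square_measure = unit_square"
  by (simp add: space_restrict_space)

lemma branch_in_square: "p \<in> unit_square \<Longrightarrow> branch j k p \<in> unit_square"
  by (auto simp: unit_square_iff branch_def divide_simps)

lemma proper_cf_map_in_square: "proper_cf_map p \<in> unit_square"
  by (auto simp: proper_cf_map_def unit_square_iff split: prod.split) linarith+

text \<open>Strictness matters: at \<open>fst p = 1\<close> the denominator becomes the integer b +
  1, whose fractional part is 0 instead of 1, and likewise in the second coordinate.\<close>

lemma proper_cf_map_branch:
  assumes "p \<in> unit_square" "fst p < 1" "snd p < 1"
  shows "proper_cf_map (branch j k p) = p"
proof -
  obtain x y where p: "p = (x, y)" by (cases p)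
  have xy: "0 \<le> x" "x < 1" "0 \<le> y" "y < 1" using assms by (auto simp: p unit_square_iff)
  have f1: "\<lfloor>real (Suc j) + y\<rfloor> = int (Suc j)" using xy by (intro floor_unique) auto
  have f2: "\<lfloor>real (Suc j + k) + x\<rfloor> = int (Suc j + k)" using xy by (intro floor_unique) auto
  have e2: "real (Suc j) / (real (Suc j) / (real (Suc j + k) + x)) = real (Suc j + k) + x"
    using xy by (simp add: divide_simps)
  have "real (Suc j + k) + x \<noteq> 0" "real (Suc j) + y \<noteq> 0" using xy by linarith+
  then show ?thesis
    unfolding proper_cf_map_def branch_def p using f1 f2 e2 by (simp del: of_nat_Suc of_nat_add)
qed

lemma measurable_into_square:
  assumes "f \<in> borel_measurable borel" "\<And>p. p \<in> unit_square \<Longrightarrow> f p \<in> unit_square"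
  shows "f \<in> square_measure \<rightarrow>\<^sub>M square_measure"
proof (rule measurable_restrict_space2)
  show "f \<in> space square_measure \<rightarrow> unit_square" using assms(2) by auto
  show "f \<in> square_measure \<rightarrow>\<^sub>M lborel"
    using assms(1) by (intro measurable_restrict_space1) simp
qed

lemma branch_measurable [measurable]: "branch j k \<in> square_measure \<rightarrow>\<^sub>M square_measure"
proof (rule measurable_into_square)
  show "branch j k \<in> borel_measurable borel"
    unfolding branch_def[abs_def] borel_prod[symmetric] by measurable
qed (rule branch_in_square)

lemma branch_jacobian_measurable [measurable]: "branch_jacobian j k \<in> borel_measurable square_measure"
proof -
  have "branch_jacobian j k \<in> borel_measurable borel"
    unfolding branch_jacobian_def[abs_def] borel_prod[symmetric] by measurable
  then show ?thesis by (intro measurable_restrict_space1) simp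
qed

lemma proper_cf_map_measurable: "proper_cf_map \<in> square_measure \<rightarrow>\<^sub>M square_measure"
proof (rule measurable_into_square)
  show "proper_cf_map \<in> borel_measurable borel"
    unfolding proper_cf_map_def borel_prod[symmetric] by measurable
qed (rule proper_cf_map_in_square)

lemma transfer_measurable:
  assumes [measurable]: "f \<in> borel_measurable square_measure"
  shows "transfer f \<in> borel_measurable square_measure"
  unfolding transfer_def[abs_def] by measurable

section \<open>Change of variables along the branches\<close>

lemma nn_integral_inverse_branch:
  fixes G :: "real \<Rightarrow> ennreal"
  assumes G [measurable]: "G \<in> borel_measurable borel" and N: "0 < N" and b: "0 < b"
  shows "(\<integral>\<^sup>+x. G x * indicator {N / (b + 1)..N / b} x \<partial>lborel) =
    (\<integral>\<^sup>+u. ennreal (N / (b + u)\<^sup>2) * G (N / (b + u)) * indicator {0..1} u \<partial>lborel)"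
proof -
  \<comment> \<open>The branch u |-> N / (b + u) is decreasing, while the substitution rule is
    applied to an increasing map. Hence the reflection u = 1 - v, undone afterwards by an affine
    substitution.\<close>
  let ?g = "\<lambda>v. N / (b + 1 - v)" and ?g' = "\<lambda>v. N / (b + 1 - v)\<^sup>2"
  have "(\<integral>\<^sup>+x. G x * indicator {?g 0..?g 1} x \<partial>lborel) =
      (\<integral>\<^sup>+v. G (?g v) * ennreal (?g' v) * indicator {0..1} v \<partial>lborel)"
  proof (rule nn_integral_substitution_aux)
    fix v :: real assume v: "v \<in> {0..1}"
    then have "b + 1 - v \<noteq> 0" using b by auto
    then show "(?g has_real_derivative ?g' v) (at v)"
      by (auto intro!: derivative_eq_intros simp: power2_eq_square)
    show "0 \<le> ?g' v" using N by simp
  next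
    show "continuous_on {0..1} ?g'" using b by (intro continuous_intros) auto
  qed auto
  also have "\<dots> = (\<integral>\<^sup>+u. G (?g (1 + -1 * u)) * ennreal (?g' (1 + -1 * u)) * indicator {0..1} (1 + -1 * u) \<partial>lborel)"
    by (subst nn_integral_real_affine[where c = "-1" and t = 1]) simp_all
  also have "\<dots> = (\<integral>\<^sup>+u. ennreal (N / (b + u)\<^sup>2) * G (N / (b + u)) * indicator {0..1} u \<partial>lborel)"
    by (intro nn_integral_cong) (auto simp: indicator_def mult.commute)
  finally show ?thesis by simp
qed

text \<open>Serves both coordinates: N = 1 is the Gauss map, N = a the fibre map sending x to the
  fractional part of a / x. For 0 < x \<le> 1 the floor of N / x is at least N, so the denominators
  start at b = N.\<close>

lemma nn_integral_inverse_branches: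
  fixes G :: "real \<Rightarrow> ennreal"
  assumes G [measurable]: "G \<in> borel_measurable borel" and N: "0 < N"
  shows "(\<integral>\<^sup>+x. G x * indicator {0..1} x \<partial>lborel) =
    (\<integral>\<^sup>+u. (\<Sum>k. ennreal (real N / (real (N + k) + u)\<^sup>2) * G (real N / (real (N + k) + u)))
       * indicator {0..1} u \<partial>lborel)"
proof -
  \<comment> \<open>Half-open, so that membership means one exact value of the floor. The left
    endpoints, needed for substitution on closed intervals, are null sets.\<close>
  define A where "A k = {real N / (real (N + k) + 1)<..real N / real (N + k)}" for k
  have A_iff: "x \<in> A k \<longleftrightarrow> 0 < x \<and> \<lfloor>real N / x\<rfloor> = int (N + k)" for x k
  proof (cases "0 < x")
    case True
    then show ?thesis using N unfolding A_def floor_eq_iff by (auto simp: field_simps)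
  next
    case False
    have "0 < real N / (real (N + k) + 1)" using N by simp
    then show ?thesis using False unfolding A_def by auto
  qed
  have disj: "disjoint_family A" by (auto simp: disjoint_family_on_def A_iff)
  have UN: "(\<Union>k. A k) = {0<..1}"
  proof (intro equalityI subsetI)
    fix x assume "x \<in> (\<Union>k. A k)"
    then obtain k where x: "0 < x" "\<lfloor>real N / x\<rfloor> = int (N + k)" by (auto simp: A_iff)
    then have "real N \<le> real N / x" by linarith
    then show "x \<in> {0<..1}" using x N by (simp add: field_simps)
  next
    fix x :: real assume x: "x \<in> {0<..1}"
    then have "real N \<le> real N / x" using N by (simp add: field_simps)
    then have "int N \<le> \<lfloor>real N / x\<rfloor>" by (simp add: le_floor_iff)
    then obtain k where "\<lfloor>real N / x\<rfloor> = int (N + k)" by (metis zle_iff_zadd of_nat_add)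
    then show "x \<in> (\<Union>k. A k)" using x by (auto simp: A_iff)
  qed
  have [measurable]: "A k \<in> sets borel" for k by (simp add: A_def)
  have AE1: "AE x in lborel. G x * indicator {0..1} x = G x * indicator (\<Union>k. A k) x"
    using AE_lborel_singleton[of 0] by eventually_elim (auto simp: UN indicator_def)
  have AE2: "AE x in lborel. G x * indicator (A k) x =
      G x * indicator {real N / (real (N + k) + 1)..real N / real (N + k)} x" for k
    using AE_lborel_singleton[of "real N / (real (N + k) + 1)"]
    by eventually_elim (auto simp: A_def indicator_def)
  have "(\<integral>\<^sup>+x. G x * indicator {0..1} x \<partial>lborel) = (\<integral>\<^sup>+x. G x * (\<Sum>k. indicator (A k) x) \<partial>lborel)"
    unfolding suminf_indicator[OF disj] by (rule nn_integral_cong_AE[OF AE1])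
  also have "\<dots> = (\<Sum>k. \<integral>\<^sup>+x. G x * indicator (A k) x \<partial>lborel)"
    unfolding ennreal_suminf_cmult[symmetric] by (rule nn_integral_suminf) simp
  also have "\<dots> = (\<Sum>k. \<integral>\<^sup>+u. ennreal (real N / (real (N + k) + u)\<^sup>2) * G (real N / (real (N + k) + u))
       * indicator {0..1} u \<partial>lborel)"
    using N by (intro suminf_cong trans[OF nn_integral_cong_AE[OF AE2] nn_integral_inverse_branch]) auto
  also have "\<dots> = (\<integral>\<^sup>+u. (\<Sum>k. ennreal (real N / (real (N + k) + u)\<^sup>2) * G (real N / (real (N + k) + u))
       * indicator {0..1} u) \<partial>lborel)"
    by (rule nn_integral_suminf[symmetric]) simp
  finally show ?thesis by simp
qed

text \<open>The integral over x is the inner one, because the fibre map in x depends on y through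
  the digit a.\<close>

lemma nn_integral_square:
  assumes "F \<in> borel_measurable square_measure"
  shows "(\<integral>\<^sup>+p. F p \<partial>square_measure) =
    (\<integral>\<^sup>+y. (\<integral>\<^sup>+x. F (x, y) * indicator {0..1} x \<partial>lborel) * indicator {0..1} y \<partial>lborel)"
proof -
  have [measurable]: "(\<lambda>p. F p * indicator unit_square p) \<in> borel_measurable borel"
    using assms by (simp add: borel_measurable_restrict_space_iff_ennreal)
  have "(\<integral>\<^sup>+p. F p \<partial>square_measure) = (\<integral>\<^sup>+p. F p * indicator unit_square p \<partial>(lborel \<Otimes>\<^sub>M lborel))"
    by (simp add: nn_integral_restrict_space lborel_prod)
  also have "\<dots> = (\<integral>\<^sup>+y. (\<integral>\<^sup>+x. F (x, y) * indicator unit_square (x, y) \<partial>lborel) \<partial>lborel)"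
    by (rule lborel_pair.nn_integral_snd[symmetric]) (simp add: lborel_prod)
  also have "\<dots> = (\<integral>\<^sup>+y. (\<integral>\<^sup>+x. F (x, y) * indicator {0..1} x \<partial>lborel) * indicator {0..1} y \<partial>lborel)"
    by (intro nn_integral_cong) (auto simp: indicator_def unit_square_def intro!: nn_integral_cong)
  finally show ?thesis .
qed

text \<open>Change variables in the outer integral with N = 1; once a branch in y is fixed, the
  digit is constant and the inner integral is handled with N = j + 1.\<close>

lemma nn_integral_transfer:
  assumes F: "F \<in> borel_measurable square_measure"
  shows "(\<integral>\<^sup>+p. transfer F p \<partial>square_measure) = (\<integral>\<^sup>+p. F p \<partial>square_measure)"
proof -
  \<comment> \<open>Extension by zero, which is Borel on the plane and has Borel slices.\<close>
  define F' where "F' p = F p * indicator unit_square p" for p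
  have F' [measurable]: "F' \<in> borel_measurable (borel \<Otimes>\<^sub>M borel)"
    using F by (simp add: borel_measurable_restrict_space_iff_ennreal F'_def[abs_def] borel_prod)
  define I where "I = (indicator {0..1} :: real \<Rightarrow> ennreal)"
  have I [measurable]: "I \<in> borel_measurable borel" by (simp add: I_def)
  have "(\<integral>\<^sup>+p. F p \<partial>square_measure) = (\<integral>\<^sup>+y. (\<integral>\<^sup>+x. F' (x, y) * I x \<partial>lborel) * I y \<partial>lborel)"
    unfolding nn_integral_square[OF F] I_def
    by (intro nn_integral_cong) (auto simp: F'_def indicator_def unit_square_def intro!: nn_integral_cong)
  also have "\<dots> = (\<integral>\<^sup>+v. (\<Sum>j. ennreal (1 / (real (Suc j) + v)\<^sup>2)
      * (\<integral>\<^sup>+x. F' (x, 1 / (real (Suc j) + v)) * I x \<partial>lborel)) * I v \<partial>lborel)"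
    using nn_integral_inverse_branches[of "\<lambda>y. \<integral>\<^sup>+x. F' (x, y) * I x \<partial>lborel" 1]
    by (simp add: I_def[symmetric])
  also have "\<dots> = (\<integral>\<^sup>+v. (\<Sum>j. ennreal (1 / (real (Suc j) + v)\<^sup>2)
      * (\<integral>\<^sup>+u. (\<Sum>k. ennreal (real (Suc j) / (real (Suc j + k) + u)\<^sup>2)
          * F' (real (Suc j) / (real (Suc j + k) + u), 1 / (real (Suc j) + v))) * I u \<partial>lborel)) * I v \<partial>lborel)"
  proof -
    have "(\<integral>\<^sup>+x. F' (x, 1 / (real (Suc j) + v)) * I x \<partial>lborel) =
        (\<integral>\<^sup>+u. (\<Sum>k. ennreal (real (Suc j) / (real (Suc j + k) + u)\<^sup>2)
          * F' (real (Suc j) / (real (Suc j + k) + u), 1 / (real (Suc j) + v))) * I u \<partial>lborel)" for j v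
      unfolding I_def by (rule nn_integral_inverse_branches) simp_all
    then show ?thesis by (simp only:)
  qed
  also have "\<dots> = (\<integral>\<^sup>+v. (\<integral>\<^sup>+u. (\<Sum>j. ennreal (1 / (real (Suc j) + v)\<^sup>2)
      * ((\<Sum>k. ennreal (real (Suc j) / (real (Suc j + k) + u)\<^sup>2)
          * F' (real (Suc j) / (real (Suc j + k) + u), 1 / (real (Suc j) + v))) * I u)) \<partial>lborel) * I v \<partial>lborel)"
    by (simp add: nn_integral_suminf nn_integral_cmult del: ennreal_suminf_multc ennreal_suminf_cmult)
  also have "\<dots> = (\<integral>\<^sup>+v. (\<integral>\<^sup>+u. transfer F (u, v) * I u \<partial>lborel) * I v \<partial>lborel)"
  proof -
    \<comment> \<open>Branches map the square into itself, so there the extension agrees with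
      \<open>F\<close>; for \<open>u\<close> outside [0, 1] both sides vanish through
      \<open>I u\<close>.\<close>
    have slice: "(\<Sum>j. ennreal (1 / (real (Suc j) + v)\<^sup>2)
      * ((\<Sum>k. ennreal (real (Suc j) / (real (Suc j + k) + u)\<^sup>2)
          * F' (real (Suc j) / (real (Suc j + k) + u), 1 / (real (Suc j) + v))) * I u))
      = transfer F (u, v) * I u" if v: "v \<in> {0..1}" for u v
    proof (cases "u \<in> {0..1}")
      case True
      then have uv: "(u, v) \<in> unit_square" using v by (simp add: unit_square_def)
      have "F' (real (Suc j) / (real (Suc j + k) + u), 1 / (real (Suc j) + v)) = F (branch j k (u, v))" for j k
        using branch_in_square[OF uv, of j k] by (simp add: F'_def branch_def)
      moreover have "ennreal (branch_jacobian j k (u, v)) = ennreal (1 / (real (Suc j) + v)\<^sup>2)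
          * ennreal (real (Suc j) / (real (Suc j + k) + u)\<^sup>2)" for j k
        unfolding branch_jacobian_def fst_conv snd_conv by (rule ennreal_mult') simp
      ultimately have "transfer F (u, v) = (\<Sum>j. ennreal (1 / (real (Suc j) + v)\<^sup>2)
        * (\<Sum>k. ennreal (real (Suc j) / (real (Suc j + k) + u)\<^sup>2)
          * F' (real (Suc j) / (real (Suc j + k) + u), 1 / (real (Suc j) + v))))"
        by (simp add: transfer_def mult.assoc del: of_nat_Suc of_nat_add)
      then show ?thesis by (simp only: mult.assoc[symmetric] ennreal_suminf_multc)
    qed (auto simp: I_def)
    show ?thesis
    proof (rule nn_integral_cong)
      fix v
      show "(\<integral>\<^sup>+u. (\<Sum>j. ennreal (1 / (real (Suc j) + v)\<^sup>2)
      * ((\<Sum>k. ennreal (real (Suc j) / (real (Suc j + k) + u)\<^sup>2)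
          * F' (real (Suc j) / (real (Suc j + k) + u), 1 / (real (Suc j) + v))) * I u)) \<partial>lborel) * I v
        = (\<integral>\<^sup>+u. transfer F (u, v) * I u \<partial>lborel) * I v"
      proof (cases "v \<in> {0..1}")
        case True
        show ?thesis by (simp only: slice[OF True])
      qed (simp add: I_def)
    qed
  qed
  also have "\<dots> = (\<integral>\<^sup>+p. transfer F p \<partial>square_measure)"
    unfolding nn_integral_square[OF transfer_measurable[OF F]] I_def ..
  finally show ?thesis ..
qed

lemma AE_square_interior: "AE p in square_measure. fst p < 1 \<and> snd p < 1"
proof -
  let ?N = "{1::real} \<times> UNIV \<union> UNIV \<times> {1::real}"
  have "{1::real} \<times> (UNIV :: real set) \<in> null_sets (lborel \<Otimes>\<^sub>M lborel)"
       "(UNIV :: real set) \<times> {1::real} \<in> null_sets (lborel \<Otimes>\<^sub>M lborel)"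
    by (auto simp: null_sets_def lborel.emeasure_pair_measure_Times)
  then have "?N \<in> null_sets lborel" by (auto simp: lborel_prod)
  then have "AE p in lborel. p \<in> unit_square \<longrightarrow> fst p < 1 \<and> snd p < 1"
    by (rule AE_I') (auto simp: unit_square_iff mem_Times_iff)
  moreover have "unit_square \<inter> space lborel \<in> sets lborel" by simp
  ultimately show ?thesis by (simp only: AE_restrict_space_iff)
qed

text \<open>Apply \<open>nn_integral_transfer\<close> to the left integrand: on each branch
  \<open>proper_cf_map\<close> undoes \<open>branch j k\<close>, so the factor \<open>g p\<close>
  comes out of the double sum. The edges where this fails are null.\<close>

lemma transfer_duality:
  assumes f: "f \<in> borel_measurable square_measure" and g: "g \<in> borel_measurable square_measure"
  shows "(\<integral>\<^sup>+p. f p * g (proper_cf_map p) \<partial>square_measure) = (\<integral>\<^sup>+p. transfer f p * g p \<partial>square_measure)"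
proof -
  note [measurable] = f g proper_cf_map_measurable
  have "(\<lambda>p. f p * g (proper_cf_map p)) \<in> borel_measurable square_measure" by measurable
  from nn_integral_transfer[OF this, symmetric]
  have "(\<integral>\<^sup>+p. f p * g (proper_cf_map p) \<partial>square_measure)
      = (\<integral>\<^sup>+p. transfer (\<lambda>p. f p * g (proper_cf_map p)) p \<partial>square_measure)" .
  also have "\<dots> = (\<integral>\<^sup>+p. transfer f p * g p \<partial>square_measure)"
  proof (rule nn_integral_cong_AE)
    show "AE p in square_measure. transfer (\<lambda>p. f p * g (proper_cf_map p)) p = transfer f p * g p"
      using AE_square_interior AE_space[of square_measure]
      by eventually_elim (simp add: transfer_def proper_cf_map_branch mult.assoc[symmetric])
  qed
  finally show ?thesis .
qed

section \<open>Contraction and distortion in logarithmic coordinates\<close>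

lemma log_shift_contraction:
  fixes a b x y :: real
  assumes a: "0 < a" "a \<le> b" and b: "1 \<le> b" and x: "0 \<le> x" and y: "0 \<le> y"
  shows "\<bar>ln (1 + a / (b + x)) - ln (1 + a / (b + y))\<bar> \<le> \<bar>ln (1 + x) - ln (1 + y)\<bar> / 2"
proof -
  have *: "\<bar>ln (1 + a / (b + x)) - ln (1 + a / (b + y))\<bar> \<le> \<bar>ln (1 + x) - ln (1 + y)\<bar> / 2"
    if x: "0 \<le> x" and xy: "x \<le> y" for x y
  proof -
    \<comment> \<open>The branch term decreases in t, so for x \<le> y the claim says that half the
      growth of ln (1 + t) compensates this decrease, that is, \<open>F\<close> is monotone.\<close>
    define F where "F t = ln (1 + t) / 2 + ln (1 + a / (b + t))" for t
    have "F x \<le> F y"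
    proof (rule DERIV_nonneg_imp_nondecreasing[OF xy])
      fix t assume "x \<le> t" "t \<le> y"
      then have t: "0 \<le> t" using x by simp
      have pos: "0 < b + t" "0 < 1 + t" "0 < 1 + a / (b + t)" using t a b by (auto intro: add_pos_nonneg)
      have "((\<lambda>t. ln (1 + t) / 2) has_real_derivative 1 / (1 + t) / 2) (at t)"
        using pos by (intro DERIV_cdivide) (auto intro!: derivative_eq_intros)
      moreover have "((\<lambda>t. ln (1 + a / (b + t))) has_real_derivative
          (- a / (b + t)\<^sup>2) / (1 + a / (b + t))) (at t)"
        using pos by (auto intro!: derivative_eq_intros simp: power2_eq_square mult_ac)
      ultimately have D: "(F has_real_derivative
          (1 / (1 + t) / 2 + (- a / (b + t)\<^sup>2) / (1 + a / (b + t)))) (at t)"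
        unfolding F_def by (rule DERIV_add)
      have "(- a / (b + t)\<^sup>2) / (1 + a / (b + t)) = - (a / ((b + t) * (b + t + a)))"
        using pos a by (simp add: divide_simps power2_eq_square)
      moreover have "a / ((b + t) * (b + t + a)) \<le> 1 / (1 + t) / 2"
      proof -
        have "a * ((1 + t) * 2) = (1 + t) * (2 * a)" by simp
        \<comment> \<open>Factor by factor: 1 + t \<le> b + t since 1 \<le> b, and 2 a \<le> b + t +
          a since a \<le> b.\<close>
        also have "\<dots> \<le> (b + t) * (b + t + a)" using a b t by (intro mult_mono) auto
        finally show ?thesis using pos a by (simp add: divide_simps mult_ac)
      qed
      ultimately have "0 \<le> 1 / (1 + t) / 2 + (- a / (b + t)\<^sup>2) / (1 + a / (b + t))" by linarith
      then show "\<exists>z. (F has_real_derivative z) (at t) \<and> 0 \<le> z" using D by blast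
    qed
    moreover have "ln (1 + x) \<le> ln (1 + y)" using x xy by simp
    moreover have "ln (1 + a / (b + y)) \<le> ln (1 + a / (b + x))"
    proof -
      have "a / (b + y) \<le> a / (b + x)" using a b x xy by (intro divide_left_mono mult_pos_pos) auto
      moreover have "0 < 1 + a / (b + y)" using a b x xy by (intro add_pos_nonneg) auto
      ultimately show ?thesis by simp
    qed
    moreover have "\<bar>A - B\<bar> \<le> \<bar>C - D\<bar> / 2" if "C / 2 + A \<le> D / 2 + B" "C \<le> D" "B \<le> A" for A B C D :: real
      using that by (auto simp: abs_if)
    ultimately show ?thesis unfolding F_def by blast
  qed
  show ?thesis
  proof (cases "x \<le> y")
    case True
    then show ?thesis using *[OF x] by blast
  next
    case False
    then show ?thesis using *[OF y, of x] by (simp add: abs_minus_commute)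
  qed
qed

text \<open>For x \<le> y the quotient (b + y) / (b + x) decreases in b, so b = 1 is the worst case,
  and there it equals the exponential of the difference of logarithms. For y \<le> x the quotient is
  at most 1.\<close>

lemma shift_ratio_le:
  fixes b x y :: real
  assumes b: "1 \<le> b" and x: "0 \<le> x" and y: "0 \<le> y"
  shows "b + y \<le> exp \<bar>ln (1 + x) - ln (1 + y)\<bar> * (b + x)"
proof (cases "y \<le> x")
  case True
  have "1 * (b + y) \<le> exp \<bar>ln (1 + x) - ln (1 + y)\<bar> * (b + x)"
    using True assms by (intro mult_mono) auto
  then show ?thesis by simp
next
  case False
  then have "exp \<bar>ln (1 + x) - ln (1 + y)\<bar> = exp (ln (1 + y) - ln (1 + x))" using x y by simp
  also have "\<dots> = (1 + y) / (1 + x)" using x y by (simp add: exp_diff)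
  finally have e: "exp \<bar>ln (1 + x) - ln (1 + y)\<bar> = (1 + y) / (1 + x)" .
  have "(b - 1) * x \<le> (b - 1) * y" using b False by (intro mult_left_mono) auto
  then have "(b + y) * (1 + x) \<le> (1 + y) * (b + x)" by (simp add: algebra_simps)
  then show ?thesis unfolding e using x by (simp add: field_simps)
qed

lemma branch_jacobian_nonneg: "0 \<le> branch_jacobian j k p"
  by (simp add: branch_jacobian_def)

lemma log_dist_nonneg: "0 \<le> log_dist p q"
  by (simp add: log_dist_def)

lemma log_dist_le_1:
  assumes "p \<in> unit_square" "q \<in> unit_square"
  shows "log_dist p q \<le> 1"
proof -
  have "\<bar>ln (1 + s) - ln (1 + t)\<bar> \<le> 1" if "0 \<le> s" "s \<le> 1" "0 \<le> t" "t \<le> 1" for s t :: real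
  proof -
    have "0 \<le> ln (1 + s)" "0 \<le> ln (1 + t)" "ln (1 + s) \<le> 1" "ln (1 + t) \<le> 1"
      using that ln_add_one_self_le_self[of s] ln_add_one_self_le_self[of t] by auto
    then show ?thesis by linarith
  qed
  then show ?thesis using assms by (simp add: log_dist_def unit_square_iff)
qed

lemma log_dist_branch:
  assumes "p \<in> unit_square" "q \<in> unit_square"
  shows "log_dist (branch j k p) (branch j k q) \<le> log_dist p q / 2"
proof -
  have max: "max a b \<le> max a' b' / 2" if "a \<le> a' / 2" "b \<le> b' / 2" for a b a' b' :: real
    using that by (auto simp: max_def)
  show ?thesis
    unfolding log_dist_def branch_def fst_conv snd_conv
    using assms by (intro max log_shift_contraction) (auto simp: unit_square_iff)
qed

text \<open>The Jacobian is a constant times two inverse squares, and by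
  \<open>shift_ratio_le\<close> each square contributes exp (2 D); hence the constant 4.\<close>

lemma branch_jacobian_distortion:
  assumes "p \<in> unit_square" "q \<in> unit_square"
  shows "branch_jacobian j k p \<le> exp (4 * log_dist p q) * branch_jacobian j k q"
proof -
  define D where "D = log_dist p q"
  have sq: "1 / (b + x)\<^sup>2 \<le> exp (2 * D) * (1 / (b + y)\<^sup>2)"
    if "1 \<le> b" "0 \<le> x" "0 \<le> y" "\<bar>ln (1 + x) - ln (1 + y)\<bar> \<le> D" for b x y :: real
  proof -
    have "b + y \<le> exp \<bar>ln (1 + x) - ln (1 + y)\<bar> * (b + x)" using that by (intro shift_ratio_le) auto
    also have "\<dots> \<le> exp D * (b + x)" using that by (intro mult_right_mono) auto
    finally have "(b + y)\<^sup>2 \<le> (exp D * (b + x))\<^sup>2" using that by (intro power_mono) auto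
    then have "(b + y)\<^sup>2 \<le> exp (2 * D) * (b + x)\<^sup>2" by (simp add: power_mult_distrib exp_double)
    moreover have "0 < (b + y)\<^sup>2" "0 < (b + x)\<^sup>2" using that by auto
    ultimately show ?thesis by (simp add: field_simps)
  qed
  have "1 / (real (Suc j) + snd p)\<^sup>2 \<le> exp (2 * D) * (1 / (real (Suc j) + snd q)\<^sup>2)"
    using assms by (intro sq) (auto simp: unit_square_iff D_def log_dist_def)
  moreover have "1 / (real (Suc j + k) + fst p)\<^sup>2 \<le> exp (2 * D) * (1 / (real (Suc j + k) + fst q)\<^sup>2)"
    using assms by (intro sq) (auto simp: unit_square_iff D_def log_dist_def)
  from mult_left_mono[OF this, of "real (Suc j)"]
  have "real (Suc j) / (real (Suc j + k) + fst p)\<^sup>2 \<le> exp (2 * D) * (real (Suc j) / (real (Suc j + k) + fst q)\<^sup>2)"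
    by (simp add: mult_ac)
  ultimately have "branch_jacobian j k p \<le> (exp (2 * D) * (1 / (real (Suc j) + snd q)\<^sup>2))
      * (exp (2 * D) * (real (Suc j) / (real (Suc j + k) + fst q)\<^sup>2))"
    unfolding branch_jacobian_def by (intro mult_mono) auto
  also have "\<dots> = (exp (2 * D) * exp (2 * D)) * branch_jacobian j k q"
    by (simp add: branch_jacobian_def)
  also have "exp (2 * D) * exp (2 * D) = exp (4 * D)" by (simp add: exp_add[symmetric])
  finally show ?thesis by (simp add: D_def)
qed

text \<open>The inequality holds term by term with one common factor: the weights contribute 4, and
  halving the distance inside \<open>f\<close> multiplies \<open>K\<close> by 2 powr -
  \<alpha>.\<close>

lemma transfer_log_cone:
  assumes \<alpha>: "0 < \<alpha>" "\<alpha> \<le> 1" and K: "0 \<le> K"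
    and f: "f \<in> log_cone square_measure (\<lambda>p q. log_dist p q powr \<alpha>) K"
  shows "transfer f \<in> log_cone square_measure (\<lambda>p q. log_dist p q powr \<alpha>) (4 + 2 powr - \<alpha> * K)"
  unfolding log_cone_def
proof (intro CollectI conjI ballI)
  show "transfer f \<in> borel_measurable square_measure"
    by (rule transfer_measurable[OF log_cone_measurable[OF f]])
  fix p q assume "p \<in> space square_measure" "q \<in> space square_measure"
  then have pq: "p \<in> unit_square" "q \<in> unit_square" by simp_all
  define D where "D = log_dist p q"
  define E where "E = ennreal (exp ((4 + 2 powr - \<alpha> * K) * D powr \<alpha>))"
  have D: "0 \<le> D" "D \<le> 1" using log_dist_nonneg log_dist_le_1[OF pq] by (auto simp: D_def)
  have term_le: "ennreal (branch_jacobian j k p) * f (branch j k p)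
      \<le> E * (ennreal (branch_jacobian j k q) * f (branch j k q))" for j k
  proof -
    \<comment> \<open>The distortion bound is linear in \<open>D\<close>; since D \<le> 1 it is
      absorbed by the \<alpha>-th power.\<close>
    have "D \<le> D powr \<alpha>" using D \<alpha> powr_mono'[of \<alpha> 1 D] by simp
    then have "branch_jacobian j k p \<le> exp (4 * D powr \<alpha>) * branch_jacobian j k q"
      using branch_jacobian_distortion[OF pq, of j k]
      by (elim order_trans) (auto simp: D_def intro!: mult_right_mono branch_jacobian_nonneg)
    then have J: "ennreal (branch_jacobian j k p) \<le> ennreal (exp (4 * D powr \<alpha>)) * ennreal (branch_jacobian j k q)"
      by (simp add: ennreal_mult'[symmetric] ennreal_leI)
    have "log_dist (branch j k p) (branch j k q) powr \<alpha> \<le> (D / 2) powr \<alpha>"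
      using log_dist_branch[OF pq, of j k] \<alpha> log_dist_nonneg by (intro powr_mono2) (auto simp: D_def)
    also have "\<dots> = 2 powr - \<alpha> * D powr \<alpha>" using D by (simp add: powr_divide powr_minus divide_simps)
    finally have "K * log_dist (branch j k p) (branch j k q) powr \<alpha> \<le> K * (2 powr - \<alpha> * D powr \<alpha>)"
      using K by (rule mult_left_mono)
    then have "ennreal (exp (K * log_dist (branch j k p) (branch j k q) powr \<alpha>)) * f (branch j k q)
        \<le> ennreal (exp (K * (2 powr - \<alpha> * D powr \<alpha>))) * f (branch j k q)"
      by (intro mult_right_mono ennreal_leI) auto
    moreover have "f (branch j k p)
        \<le> ennreal (exp (K * log_dist (branch j k p) (branch j k q) powr \<alpha>)) * f (branch j k q)"
      using branch_in_square pq by (intro log_coneD[OF f]) auto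
    ultimately have "f (branch j k p) \<le> ennreal (exp (K * (2 powr - \<alpha> * D powr \<alpha>))) * f (branch j k q)"
      by (rule order_trans[rotated])
    with J have "ennreal (branch_jacobian j k p) * f (branch j k p)
      \<le> (ennreal (exp (4 * D powr \<alpha>)) * ennreal (branch_jacobian j k q))
        * (ennreal (exp (K * (2 powr - \<alpha> * D powr \<alpha>))) * f (branch j k q))"
      by (intro mult_mono) auto
    also have "\<dots> = (ennreal (exp (4 * D powr \<alpha>)) * ennreal (exp (K * (2 powr - \<alpha> * D powr \<alpha>))))
        * (ennreal (branch_jacobian j k q) * f (branch j k q))"
      by (simp add: mult_ac)
    also have "ennreal (exp (4 * D powr \<alpha>)) * ennreal (exp (K * (2 powr - \<alpha> * D powr \<alpha>))) = E"
      by (simp add: E_def ennreal_mult'[symmetric] exp_add[symmetric] algebra_simps)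
    finally show ?thesis .
  qed
  have "transfer f p \<le> (\<Sum>j. \<Sum>k. E * (ennreal (branch_jacobian j k q) * f (branch j k q)))"
    unfolding transfer_def by (intro suminf_le summableI term_le)
  also have "\<dots> = E * transfer f q" by (simp add: transfer_def)
  finally show "transfer f p \<le> ennreal (exp ((4 + 2 powr - \<alpha> * K) * log_dist p q powr \<alpha>)) * transfer f q"
    by (simp add: E_def D_def)
qed

lemma contracting_transfer_proper_cf_map:
  assumes \<alpha>: "0 < \<alpha>" "\<alpha> \<le> 1"
  shows "contracting_transfer square_measure proper_cf_map transfer
    (\<lambda>p q. log_dist p q powr \<alpha>) 4 (2 powr - \<alpha>)"
proof (intro contracting_transfer.intro contracting_transfer_axioms.intro)
  show "prob_space square_measure"
  proof
    have "emeasure square_measure unit_square = emeasure (lborel \<Otimes>\<^sub>M lborel) ({0..1::real} \<times> {0..1::real})"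
      by (simp add: emeasure_restrict_space lborel_prod) (simp add: unit_square_def)
    then show "emeasure square_measure (space square_measure) = 1"
      by (simp add: lborel.emeasure_pair_measure_Times)
  qed
  show "proper_cf_map \<in> square_measure \<rightarrow>\<^sub>M square_measure" by (rule proper_cf_map_measurable)
  fix f g :: "real \<times> real \<Rightarrow> ennreal" and p q r
  show "transfer f \<in> borel_measurable square_measure" if "f \<in> borel_measurable square_measure"
    using that by (rule transfer_measurable)
  show "transfer f p = transfer g p" if "\<And>q. q \<in> space square_measure \<Longrightarrow> f q = g q" "p \<in> space square_measure"
    using that branch_in_square by (auto simp: transfer_def intro!: suminf_cong)
  show "transfer (\<lambda>q. f q + r * g q) p = transfer f p + r * transfer g p"
    by (simp add: transfer_def distrib_left suminf_add[symmetric] mult.left_commute[of _ r])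
  show "(\<integral>\<^sup>+p. f p * g (proper_cf_map p) \<partial>square_measure) = (\<integral>\<^sup>+p. transfer f p * g p \<partial>square_measure)"
    if "f \<in> borel_measurable square_measure" "g \<in> borel_measurable square_measure"
    using that by (rule transfer_duality)
  show "0 \<le> log_dist p q powr \<alpha>" by simp
  show "log_dist p q powr \<alpha> \<le> 1" if "p \<in> space square_measure" "q \<in> space square_measure"
    using powr_mono2[OF less_imp_le[OF \<alpha>(1)] log_dist_nonneg log_dist_le_1[of p q]] that by simp
  show "0 \<le> (4::real)" "0 \<le> 2 powr - \<alpha>" by simp_all
  show "2 powr - \<alpha> < 1" using \<alpha> by (simp add: powr_minus divide_simps)
  show "transfer f \<in> log_cone square_measure (\<lambda>p q. log_dist p q powr \<alpha>) (4 + 2 powr - \<alpha> * K)"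
    if "0 \<le> K" "f \<in> log_cone square_measure (\<lambda>p q. log_dist p q powr \<alpha>) K" for K
    by (rule transfer_log_cone[OF \<alpha> that])
qed

section \<open>Decay of correlations for Hoelder functions\<close>

text \<open>On [0, 1] the slope of ln (1 + t) is at least 1/2, which costs a factor 2 per
  coordinate; adding the two coordinates costs another 2.\<close>

lemma dist_le_log_dist:
  assumes p: "p \<in> unit_square" and q: "q \<in> unit_square"
  shows "dist p q \<le> 4 * log_dist p q"
proof -
  have *: "\<bar>x - y\<bar> \<le> 2 * \<bar>ln (1 + x) - ln (1 + y)\<bar>"
    if xy: "0 \<le> x" "x \<le> 1" "0 \<le> y" "y \<le> 1" for x y :: real
  proof -
    have *: "y - x \<le> 2 * (ln (1 + y) - ln (1 + x))" if "0 \<le> x" "x \<le> y" "y \<le> 1" for x y :: real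
    proof -
      have "(y - x) / 2 \<le> (y - x) / (1 + y)" using that by (intro divide_left_mono) auto
      also have "\<dots> = 1 - (1 + x) / (1 + y)" using that by (simp add: divide_simps)
      also have "\<dots> \<le> - ln ((1 + x) / (1 + y))"
        using ln_le_minus_one[of "(1 + x) / (1 + y)"] that by simp
      also have "\<dots> = ln (1 + y) - ln (1 + x)" using that by (simp add: ln_div)
      finally show ?thesis by simp
    qed
    show ?thesis
      using *[of x y] *[of y x] xy by (cases "x \<le> y") (auto simp: abs_if)
  qed
  have "dist p q \<le> \<bar>fst p - fst q\<bar> + \<bar>snd p - snd q\<bar>"
    unfolding dist_prod_def dist_real_def by (rule order_trans[OF sqrt_sum_squares_le_sum_abs]) simp
  also have "\<dots> \<le> 2 * log_dist p q + 2 * log_dist p q"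
    using *[of "fst p" "fst q"] *[of "snd p" "snd q"] p q
    by (intro add_mono) (auto simp: unit_square_iff log_dist_def elim!: order_trans)
  finally show ?thesis by simp
qed

text \<open>The source of measurability for the Hoelder function in a correlation.\<close>

lemma hoelder_imp_continuous_on:
  fixes f :: "'a::metric_space \<Rightarrow> real"
  assumes \<alpha>: "0 < \<alpha>" and H: "\<And>p q. p \<in> A \<Longrightarrow> q \<in> A \<Longrightarrow> \<bar>f p - f q\<bar> \<le> H * dist p q powr \<alpha>"
  shows "continuous_on A f"
  unfolding continuous_on_def
proof
  fix q assume q: "q \<in> A"
  have "((\<lambda>p. H * dist p q powr \<alpha>) \<longlongrightarrow> H * dist q q powr \<alpha>) (at q within A)"
    using \<alpha> by (intro tendsto_intros) auto
  then have lim: "((\<lambda>p. H * dist p q powr \<alpha>) \<longlongrightarrow> 0) (at q within A)" by simp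
  have "((\<lambda>p. f p - f q) \<longlongrightarrow> 0) (at q within A)"
    by (rule Lim_null_comparison[OF _ lim]) (use H q in \<open>auto simp: eventually_at_filter\<close>)
  then show "(f \<longlongrightarrow> f q) (at q within A)" by (simp add: LIM_zero_iff)
qed

text \<open>The shift makes the function at least 4 H, while its oscillation is at most 4 H D with D
  the cone distance. The relative change is then at most D, and 1 + D \<le> exp D gives the constant
  1 whatever S and H are. The 4 comes from \<open>dist_le_log_dist\<close> and 4 powr \<alpha> \<le>
  4.\<close>

lemma hoelder_in_log_cone:
  assumes \<alpha>: "0 < \<alpha>" "\<alpha> \<le> 1" and S: "\<And>p. p \<in> unit_square \<Longrightarrow> \<bar>\<phi> p\<bar> \<le> S"
    and H0: "0 \<le> H"
    and H: "\<And>p q. p \<in> unit_square \<Longrightarrow> q \<in> unit_square \<Longrightarrow> \<bar>\<phi> p - \<phi> q\<bar> \<le> H * dist p q powr \<alpha>"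
  shows "\<phi> \<in> borel_measurable square_measure"
    and "(\<lambda>p. ennreal (\<phi> p + (S + 4 * H))) \<in> log_cone square_measure (\<lambda>p q. log_dist p q powr \<alpha>) 1"
proof -
  have "\<phi> \<in> borel_measurable (restrict_space borel unit_square)"
    by (rule borel_measurable_continuous_on_restrict[OF hoelder_imp_continuous_on[OF \<alpha>(1) H]])
  then show m: "\<phi> \<in> borel_measurable square_measure"
    by (simp add: measurable_cong_sets[OF sets_restrict_space_cong[OF sets_lborel] refl])
  show "(\<lambda>p. ennreal (\<phi> p + (S + 4 * H))) \<in> log_cone square_measure (\<lambda>p q. log_dist p q powr \<alpha>) 1"
    unfolding log_cone_def
  proof (intro CollectI conjI ballI)
    show "(\<lambda>p. ennreal (\<phi> p + (S + 4 * H))) \<in> borel_measurable square_measure"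
      using m by measurable
    fix p q assume "p \<in> space square_measure" "q \<in> space square_measure"
    then have pq: "p \<in> unit_square" "q \<in> unit_square" by simp_all
    define D where "D = log_dist p q powr \<alpha>"
    have D: "0 \<le> D" by (simp add: D_def)
    have "dist p q powr \<alpha> \<le> (4 * log_dist p q) powr \<alpha>"
      using dist_le_log_dist[OF pq] \<alpha> by (intro powr_mono2) auto
    also have "\<dots> = 4 powr \<alpha> * D" unfolding D_def using log_dist_nonneg by (simp add: powr_mult)
    also have "\<dots> \<le> 4 * D" using powr_mono[of \<alpha> 1 "4::real"] \<alpha> D by (intro mult_right_mono) auto
    finally have "H * dist p q powr \<alpha> \<le> H * (4 * D)" using H0 by (rule mult_left_mono)
    moreover have "4 * H * D \<le> (\<phi> q + (S + 4 * H)) * D"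
      using S[OF pq(2)] D by (intro mult_right_mono) auto
    ultimately have "\<phi> p + (S + 4 * H) \<le> (1 + D) * (\<phi> q + (S + 4 * H))"
      using H[OF pq] by (simp add: algebra_simps)
    also have "\<dots> \<le> exp D * (\<phi> q + (S + 4 * H))"
      using S[OF pq(2)] H0 exp_ge_add_one_self[of D] by (intro mult_right_mono) auto
    finally show "ennreal (\<phi> p + (S + 4 * H)) \<le> ennreal (exp (1 * log_dist p q powr \<alpha>)) * ennreal (\<phi> q + (S + 4 * H))"
      by (simp add: D_def ennreal_mult'[symmetric] ennreal_leI)
  qed
qed

text \<open>Both functions are made nonnegative by adding constants, which leaves the correlation
  unchanged because the measure is invariant; then \<open>correlation_bound\<close> applies.\<close>

lemma proper_cf_map_correlation_decay:
  assumes h: "h \<in> log_cone square_measure (\<lambda>p q. log_dist p q powr 1) K0"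
    and K0: "0 \<le> K0" and h_int: "(\<integral>\<^sup>+p. h p \<partial>square_measure) = 1"
    and pres: "measure_preserving (density square_measure h) proper_cf_map"
  shows "exponentially_mixing (density square_measure h) proper_cf_map"
  unfolding exponentially_mixing_def
proof (intro conjI allI impI)
  show "measure_preserving (density square_measure h) proper_cf_map" by (rule pres)
  fix \<alpha> :: real
  assume "0 < \<alpha> \<and> \<alpha> \<le> 1"
  then have \<alpha>: "0 < \<alpha>" "\<alpha> \<le> 1" by simp_all
  interpret contracting_transfer square_measure proper_cf_map transfer
      "\<lambda>p q. log_dist p q powr \<alpha>" 4 "2 powr - \<alpha>"
    by (rule contracting_transfer_proper_cf_map[OF \<alpha>])
  define \<mu> where "\<mu> = density square_measure h"
  note [measurable] = log_cone_measurable[OF h]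
  interpret \<mu>: prob_space \<mu>
    unfolding \<mu>_def using h_int by (intro prob_space_density) simp_all
  have space_\<mu> [simp]: "space \<mu> = unit_square" by (simp add: \<mu>_def)
  have sets_\<mu> [measurable_cong]: "sets \<mu> = sets square_measure" by (simp add: \<mu>_def)
  have meas_\<mu>: "borel_measurable \<mu> = borel_measurable square_measure"
    by (rule measurable_cong_sets) (simp_all add: sets_\<mu>)
  \<comment> \<open>K0 + 1 accommodates the product of the shifted \<open>\<phi>\<close> (cone
    constant 1) with \<open>h\<close> (constant \<open>K0\<close>). The last summand exceeds the
    threshold 4 / (1 - 2 powr - \<alpha>) for strict improvement.\<close>
  define K where "K = K0 + 1 + 8 / (1 - 2 powr - \<alpha>)"
  have K1: "0 < 1 - 2 powr - \<alpha>" using \<kappa>_less_1 by simp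
  have K: "4 + 2 powr - \<alpha> * K < K"
  proof -
    have "8 / (1 - 2 powr - \<alpha>) * (1 - 2 powr - \<alpha>) = 8"
      by (rule nonzero_eq_divide_eq[THEN iffD1]) (use K1 in auto)
    then have "4 < 8 / (1 - 2 powr - \<alpha>) * (1 - 2 powr - \<alpha>)" by linarith
    also have "\<dots> \<le> K * (1 - 2 powr - \<alpha>)" using K0 K1 by (intro mult_right_mono) (auto simp: K_def)
    finally show ?thesis by (simp add: algebra_simps)
  qed
  have K_ge: "K0 + 1 \<le> K" using K1 by (simp add: K_def)
  have h\<alpha>: "h \<in> log_cone square_measure (\<lambda>p q. log_dist p q powr \<alpha>) K0"
  proof (rule log_cone_mono[OF h])
    fix p q assume "p \<in> space square_measure" "q \<in> space square_measure"
    then have "log_dist p q \<le> 1" by (intro log_dist_le_1) simp_all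
    then show "K0 * log_dist p q powr 1 \<le> K0 * log_dist p q powr \<alpha>"
      using \<alpha> K0 log_dist_nonneg[of p q] by (intro mult_left_mono powr_mono') auto
  qed
  have hK: "h \<in> log_cone square_measure (\<lambda>p q. log_dist p q powr \<alpha>) K"
    by (rule log_cone_mono[OF h\<alpha>]) (use K_ge in \<open>auto intro: mult_right_mono\<close>)
  have pow_\<mu>: "proper_cf_map ^^ n \<in> \<mu> \<rightarrow>\<^sub>M \<mu>" "distr \<mu> \<mu> (proper_cf_map ^^ n) = \<mu>" for n
    using measure_preserving_distr_pow[OF pres] by (simp_all add: \<mu>_def)
  note [measurable] = pow_\<mu>(1)
  have decay: "\<bar>(LINT p|\<mu>. \<phi> p * \<psi> ((proper_cf_map ^^ n) p)) - (LINT p|\<mu>. \<phi> p) * (LINT p|\<mu>. \<psi> p)\<bar>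
      \<le> 16 * exp K * (1 - gap K) ^ n * (S + H) * B"
    if S: "\<forall>p\<in>space \<mu>. \<bar>\<phi> p\<bar> \<le> S"
      and H: "\<forall>p\<in>space \<mu>. \<forall>q\<in>space \<mu>. \<bar>\<phi> p - \<phi> q\<bar> \<le> H * dist p q powr \<alpha>"
      and \<psi>: "\<psi> \<in> borel_measurable \<mu>" and B: "AE p in \<mu>. \<bar>\<psi> p\<bar> \<le> B"
    for \<phi> \<psi> :: "real \<times> real \<Rightarrow> real" and S H B :: real and n :: nat
  proof -
    have S0: "0 \<le> S" using S by (force simp: unit_square_def)
    \<comment> \<open>\<open>H\<close> ranges over all reals; two points at distance 1 show that it
      is nonnegative.\<close>
    have "\<bar>\<phi> (0, 0) - \<phi> (1, 0)\<bar> \<le> H * dist (0::real, 0::real) (1, 0) powr \<alpha>"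
      using H by (simp add: unit_square_def)
    then have H0: "0 \<le> H" by (simp add: dist_prod_def dist_real_def)
    have B0: "0 \<le> B"
    proof -
      have "AE p in \<mu>. 0 \<le> B" using B by eventually_elim auto
      then show ?thesis by simp
    qed
    define a where "a = S + 4 * H"
    note \<phi>_cone = hoelder_in_log_cone[OF \<alpha> _ H0, of \<phi> S]
    have \<phi>_m [measurable]: "\<phi> \<in> borel_measurable square_measure"
      using S H by (intro \<phi>_cone) auto
    have "(\<lambda>p. ennreal (\<phi> p + a)) \<in> log_cone square_measure (\<lambda>p q. log_dist p q powr \<alpha>) 1"
      unfolding a_def using S H by (intro \<phi>_cone) auto
    from log_cone_mult[OF this h\<alpha>]
    have \<phi>h: "(\<lambda>p. ennreal (\<phi> p + a) * h p) \<in> log_cone square_measure (\<lambda>p q. log_dist p q powr \<alpha>) K"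
      by (rule log_cone_mono) (use K_ge in \<open>auto intro: mult_right_mono\<close>)
    \<comment> \<open>Truncation turns the almost everywhere bound into an everywhere bound. After n
      steps \<open>\<psi>\<close> and \<open>\<eta>\<close> still agree almost everywhere, by
      invariance of the measure.\<close>
    define \<eta> where "\<eta> p = max (- B) (min B (\<psi> p))" for p
    have \<eta>_m [measurable]: "\<eta> \<in> borel_measurable square_measure"
      using \<psi> unfolding \<eta>_def meas_\<mu> by measurable
    have \<eta>_bound: "\<bar>\<eta> p\<bar> \<le> B" for p using B0 by (auto simp: \<eta>_def)
    have \<eta>_eq: "AE p in \<mu>. \<psi> p = \<eta> p" using B by eventually_elim (auto simp: \<eta>_def)
    have int_eq: "(LINT p|\<mu>. \<psi> p) = (LINT p|\<mu>. \<eta> p)"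
      using \<psi> \<eta>_eq by (intro integral_cong_AE) simp_all
    have "AE p in distr \<mu> \<mu> (proper_cf_map ^^ n). \<psi> p = \<eta> p" unfolding pow_\<mu>(2) by (rule \<eta>_eq)
    then have "AE p in \<mu>. \<psi> ((proper_cf_map ^^ n) p) = \<eta> ((proper_cf_map ^^ n) p)"
      by (rule AE_distrD[OF pow_\<mu>(1)])
    moreover have \<psi>_m [measurable]: "\<psi> \<in> borel_measurable square_measure" using \<psi> by (simp add: meas_\<mu>)
    ultimately have corr_eq: "(LINT p|\<mu>. \<phi> p * \<psi> ((proper_cf_map ^^ n) p))
        = (LINT p|\<mu>. \<phi> p * \<eta> ((proper_cf_map ^^ n) p))"
      by (intro integral_cong_AE) (auto elim: eventually_mono)
    have bounds: "0 \<le> \<phi> p + a \<and> \<phi> p + a \<le> 2 * S + 4 * H" if "p \<in> space square_measure" for p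
    proof -
      have "\<bar>\<phi> p\<bar> \<le> S" using S that by simp
      then show ?thesis using H0 by (auto simp: a_def)
    qed
    have "\<bar>(LINT p|\<mu>. (\<phi> p + a) * (\<eta> ((proper_cf_map ^^ n) p) + B)) - (LINT p|\<mu>. (\<phi> p + a)) * (LINT p|\<mu>. (\<eta> p + B))\<bar>
        \<le> exp K * (2 * S + 4 * H) * (1 - gap K) ^ n * (2 * B)"
      unfolding \<mu>_def
    proof (rule correlation_bound[OF K hK h_int pres \<phi>h _ bounds])
      show "0 \<le> \<eta> p + B \<and> \<eta> p + B \<le> 2 * B" for p using \<eta>_bound[of p] by auto
    qed simp_all
    moreover have "(LINT p|\<mu>. (\<phi> p + a) * (\<eta> ((proper_cf_map ^^ n) p) + B)) - (LINT p|\<mu>. (\<phi> p + a)) * (LINT p|\<mu>. (\<eta> p + B))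
        = (LINT p|\<mu>. \<phi> p * \<eta> ((proper_cf_map ^^ n) p)) - (LINT p|\<mu>. \<phi> p) * (LINT p|\<mu>. \<eta> p)"
    proof -
      have i1: "integrable \<mu> \<phi>"
        by (rule \<mu>.integrable_const_bound[where B = S]) (use S in auto)
      have i2: "integrable \<mu> \<eta>"
        by (rule \<mu>.integrable_const_bound[where B = B]) (use \<eta>_bound in auto)
      have i3: "integrable \<mu> (\<lambda>p. \<eta> ((proper_cf_map ^^ n) p))"
        by (rule \<mu>.integrable_const_bound[where B = B]) (use \<eta>_bound in auto)
      have i4: "integrable \<mu> (\<lambda>p. \<phi> p * \<eta> ((proper_cf_map ^^ n) p))"
      proof (rule \<mu>.integrable_const_bound[where B = "S * B"])
        show "AE p in \<mu>. norm (\<phi> p * \<eta> ((proper_cf_map ^^ n) p)) \<le> S * B"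
          unfolding real_norm_def abs_mult using S S0 by (intro AE_I2 mult_mono \<eta>_bound) auto
      qed simp
      \<comment> \<open>With this equality all terms produced by the added constants cancel.\<close>
      have inv: "(LINT p|\<mu>. \<eta> ((proper_cf_map ^^ n) p)) = (LINT p|\<mu>. \<eta> p)"
        using integral_distr[OF pow_\<mu>(1), of \<eta> n] by (simp add: pow_\<mu>(2))
      have "(\<lambda>p. (\<phi> p + a) * (\<eta> ((proper_cf_map ^^ n) p) + B)) =
          (\<lambda>p. \<phi> p * \<eta> ((proper_cf_map ^^ n) p) + B * \<phi> p + a * \<eta> ((proper_cf_map ^^ n) p) + a * B)"
        by (simp add: fun_eq_iff algebra_simps)
      then show ?thesis
        using i1 i2 i3 i4 by (simp add: inv \<mu>.prob_space[simplified] algebra_simps)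
    qed
    moreover have "exp K * (2 * S + 4 * H) * (1 - gap K) ^ n * (2 * B)
        \<le> 16 * exp K * (1 - gap K) ^ n * (S + H) * B"
    proof -
      have "(2 * S + 4 * H) * 2 \<le> 16 * (S + H)" using S0 H0 by simp
      moreover have "0 \<le> exp K * (1 - gap K) ^ n * B" using B0 gap_bounds[OF K] by simp
      ultimately have "exp K * (1 - gap K) ^ n * B * ((2 * S + 4 * H) * 2)
          \<le> exp K * (1 - gap K) ^ n * B * (16 * (S + H))"
        by (rule mult_left_mono)
      then show ?thesis by (simp only: mult_ac)
    qed
    ultimately show ?thesis unfolding corr_eq int_eq by linarith
  qed
  show "\<exists>C \<theta>. 0 < \<theta> \<and> \<theta> < 1 \<and>
         (\<forall>(\<phi> :: real \<times> real \<Rightarrow> real) (\<psi> :: real \<times> real \<Rightarrow> real) S H B.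
            (\<forall>p\<in>space (density square_measure h). \<bar>\<phi> p\<bar> \<le> S) \<longrightarrow>
            (\<forall>p\<in>space (density square_measure h). \<forall>q\<in>space (density square_measure h).
               \<bar>\<phi> p - \<phi> q\<bar> \<le> H * dist p q powr \<alpha>) \<longrightarrow>
            \<psi> \<in> borel_measurable (density square_measure h) \<longrightarrow>
            (AE p in density square_measure h. \<bar>\<psi> p\<bar> \<le> B) \<longrightarrow>
            (\<forall>n. \<bar>(LINT p|density square_measure h. \<phi> p * \<psi> ((proper_cf_map ^^ n) p))
                - (LINT p|density square_measure h. \<phi> p) * (LINT p|density square_measure h. \<psi> p)\<bar>
                   \<le> C * \<theta> ^ n * (S + H) * B))"
    unfolding \<mu>_def[symmetric]
    using gap_bounds[OF K] decay
    by (intro exI[of _ "16 * exp K"] exI[of _ "1 - gap K"] conjI allI impI) auto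
qed

theorem theorem4p1:
  shows "\<exists>\<mu> :: (real \<times> real) measure.
    prob_space \<mu> \<and>
    mutually_absolutely_continuous \<mu> (restrict_space lborel unit_square) \<and>
    ergodic \<mu> proper_cf_map \<and>
    exponentially_mixing \<mu> proper_cf_map"
proof -
  interpret contracting_transfer square_measure proper_cf_map transfer
      "\<lambda>p q. log_dist p q powr 1" 4 "2 powr - 1"
    by (rule contracting_transfer_proper_cf_map) simp_all
  \<comment> \<open>The requirement 4 + K / 2 < K means K > 8; 10 is a convenient choice.\<close>
  have K: "4 + 2 powr - 1 * 10 < (10::real)" by (simp add: powr_minus)
  obtain h where h: "h \<in> log_cone square_measure (\<lambda>p q. log_dist p q powr 1) 10"
    and h_int: "(\<integral>\<^sup>+p. h p \<partial>square_measure) = 1"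
    and inv: "\<And>A. A \<in> sets square_measure \<Longrightarrow>
      (\<integral>\<^sup>+p. h p * indicator A (proper_cf_map p) \<partial>square_measure) = (\<integral>\<^sup>+p. h p * indicator A p \<partial>square_measure)"
    using invariant_density[OF K] by blast
  note [measurable] = log_cone_measurable[OF h]
  define \<mu> where "\<mu> = density square_measure h"
  have prob: "prob_space \<mu>"
    unfolding \<mu>_def using h_int by (intro prob_space_density) simp_all
  \<comment> \<open>The cone bound gives the density the lower bound exp (-10) on the whole square,
    so null sets of \<open>\<mu>\<close> are Lebesgue null.\<close>
  have h_pos: "h p \<noteq> 0" if "p \<in> space square_measure" for p
  proof
    assume "h p = 0"
    with log_cone_bounds(1)[OF h _ _ that, of 1] have "ennreal (exp (- 10) * 1) \<le> 0"
      by (simp add: h_int)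
    then show False by simp
  qed
  have "absolutely_continuous square_measure \<mu>"
    unfolding \<mu>_def by (rule absolutely_continuousI_density) simp
  moreover have "absolutely_continuous \<mu> square_measure"
    unfolding absolutely_continuous_def
  proof
    fix A assume "A \<in> null_sets \<mu>"
    then have A: "A \<in> sets square_measure" "AE p in square_measure. p \<in> A \<longrightarrow> h p = 0"
      by (simp_all add: \<mu>_def null_sets_density_iff)
    have "AE p in square_measure. p \<notin> A"
      using A(2) AE_space by eventually_elim (use h_pos in auto)
    then show "A \<in> null_sets square_measure" using A(1) by (simp add: AE_iff_null_sets)
  qed
  ultimately have ac: "mutually_absolutely_continuous \<mu> square_measure"
    by (simp add: mutually_absolutely_continuous_def \<mu>_def)
  have "measure_preserving \<mu> proper_cf_map"
    unfolding \<mu>_def by (rule density_preserved[OF log_cone_measurable[OF h] inv])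
  then have mix: "exponentially_mixing \<mu> proper_cf_map"
    unfolding \<mu>_def by (intro proper_cf_map_correlation_decay[OF h _ h_int]) simp_all
  have "sets \<mu> = sets (restrict_space borel unit_square)"
    by (simp add: \<mu>_def sets_restrict_space_cong[OF sets_lborel])
  then have "ergodic \<mu> proper_cf_map"
    by (rule exponentially_mixing_imp_ergodic[OF prob _ mix])
  with prob ac mix show ?thesis by blast
qed

end
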